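(* Let $A=(a_{ij})\in D_n$ (respectively, $A\in GD_n$) with $a_{ii}\neq 0$ for all $i\in\{1,\dots,n\}$. Then $\rho(H_{FGS})<1$ (i.e., the sequence $\{x^{(i)}\}$ generated by the FGS scheme converges to the unique solution of $Ax=b$ for any choice of the initial guess $x^{(0)}$) if and only if both of the following hold: (i) $A$ has no $2\times 2$ irreducible principal submatrix belonging to $DE_2$ (respectively, $GDE_2$); (ii) $A$ has no irreducible principal submatrix $A_k=A(i_1,i_2,\dots,i_k)$, $3\le k\le n$, such that $D_{A_k}^{-1}A_k\in \mathscr{U}^{\psi}_k\cap DE_k$ (respectively, $D_{A_k}^{-1}A_k\in\mathscr{U}^{\psi}_k\cap GDE_k$) for some $\psi\in\mathbb{R}$, where $D_{A_k}=\mathrm{diag}(a_{i_1i_1},a_{i_2i_2},\dots,a_{i_ki_k})$.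
   Context: For complex $n\times n$ matrices $A=(a_{ij})$: $A\in D_n$ (diagonally dominant by row) if $|a_{ii}|\ge\sum_{j\ne i}|a_{ij}|$ for all $i$; $A\in DE_n$ (diagonally equipotent) if equality holds for all $i$; $A\in GD_n$ (generalized diagonally dominant) if there are positive constants $\alpha_1,\dots,\alpha_n$ with $\alpha_i|a_{ii}|\ge\sum_{j\ne i}\alpha_j|a_{ij}|$ for all $i$; $A\in GDE_n$ (generalized diagonally equipotent) if such constants exist with equality for all $i$. $A(i_1,\dots,i_k)$, $i_1<\dots<i_k$, is the principal submatrix of $A$ with rows and columns $i_1,\dots,i_k$. Write $A=D_A-L_A-U_A$ with $D_A=\mathrm{diag}(a_{11},\dots,a_{nn})$, $L_A$ strictly lower triangular, $U_A$ strictly upper triangular. The forward Gauss-Seidel (FGS) iteration matrix is $H_{FGS}=(D_A-L_A)^{-1}U_A$, and the FGS scheme for $Ax=b$ is $x^{(i+1)}=H_{FGS}x^{(i)}+(D_A-L_A)^{-1}b$, $i=0,1,2,\dots$. $\rho$ denotes the spectral radius. A matrix $(e^{i\psi_{rs}})\in\mathbb{C}^{k\times k}$ ($\psi_{rs}\in\mathbb{R}$, $i=\sqrt{-1}$) is a $\psi$-ray pattern matrix ($\psi\in\mathbb{R}$) if, modulo $2\pi$: (1) $\psi_{rs}+\psi_{sr}\equiv\psi$ for all $r\ne s$; (2) $\psi_{rs}-\psi_{rt}\equiv\psi_{ts}+\pi$ whenever $r<s<t$ or $s<t<r$ or $t<r<s$; (3) $\psi_{rs}-\psi_{rt}\equiv\psi_{ts}-\psi+\pi$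 whenever $r<t<s$ or $t<s<r$ or $s<r<t$; (4) $\psi_{rr}=0$ for all $r$. $\mathscr{U}^{\psi}_k$ is the set of $k\times k$ complex matrices $B=(b_{rs})$ for which there exist $\eta\in\mathbb{R}$ and a $\psi$-ray pattern matrix $(e^{i\psi_{rs}})$ with $b_{rs}=e^{i\eta}|b_{rs}|e^{i\psi_{rs}}$ for all $r,s$. *)

theory Defs
  imports
    "Jordan_Normal_Form.Spectral_Radius"
    "Jordan_Normal_Form.DL_Submatrix"
    "Jordan_Normal_Form.Gauss_Jordan_Elimination"
    "HOL-Combinatorics.Permutations"
    "HOL-Library.Real_Mod"
begin

section \<open>Diagonally dominant and equipotent matrices\<close>

definition D_mats :: "nat \<Rightarrow> complex mat set" where
  "D_mats n = {A \<in> carrier_mat n n. \<forall>i<n. cmod (A $$ (i,i)) \<ge> (\<Sum>j\<in>{..<n} - {i}. cmod (A $$ (i,j)))}"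

definition DE_mats :: "nat \<Rightarrow> complex mat set" where
  "DE_mats n = {A \<in> carrier_mat n n. \<forall>i<n. cmod (A $$ (i,i)) = (\<Sum>j\<in>{..<n} - {i}. cmod (A $$ (i,j)))}"

definition GD_mats :: "nat \<Rightarrow> complex mat set" where
  "GD_mats n = {A \<in> carrier_mat n n. \<exists>\<alpha> :: nat \<Rightarrow> real. (\<forall>i<n. \<alpha> i > 0) \<and>
     (\<forall>i<n. \<alpha> i * cmod (A $$ (i,i)) \<ge> (\<Sum>j\<in>{..<n} - {i}. \<alpha> j * cmod (A $$ (i,j))))}"

definition GDE_mats :: "nat \<Rightarrow> complex mat set" where
  "GDE_mats n = {A \<in> carrier_mat n n. \<exists>\<alpha> :: nat \<Rightarrow> real. (\<forall>i<n. \<alpha> i > 0) \<and>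
     (\<forall>i<n. \<alpha> i * cmod (A $$ (i,i)) = (\<Sum>j\<in>{..<n} - {i}. \<alpha> j * cmod (A $$ (i,j))))}"


section \<open>Principal submatrices and irreducibility\<close>

text \<open>For \<open>I = {i\<^sub>1 < \<dots> < i\<^sub>k}\<close> this is \<open>A(i\<^sub>1,\<dots>,i\<^sub>k)\<close>: \<open>submatrix\<close> enumerates its
  index sets increasingly. Indices start at 0.\<close>

abbreviation principal_submatrix :: "complex mat \<Rightarrow> nat set \<Rightarrow> complex mat" where
  "principal_submatrix A I \<equiv> submatrix A I I"

text \<open>Some simultaneous permutation of rows and columns, i.e. some \<open>P A P\<^sup>T\<close> with \<open>P\<close> a
  permutation matrix, is block upper triangular with two nonempty square diagonal blocks of
  orders \<open>m\<close> and \<open>n - m\<close>. In particular every matrix of order 1 is irreducible.\<close>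

definition reducible_mat :: "complex mat \<Rightarrow> bool" where
  "reducible_mat A \<longleftrightarrow> (\<exists>p m. p permutes {..<dim_row A} \<and> 0 < m \<and> m < dim_row A \<and>
     (\<forall>i j. m \<le> i \<and> i < dim_row A \<and> j < m \<longrightarrow> A $$ (p i, p j) = 0))"

definition irreducible_mat :: "complex mat \<Rightarrow> bool" where
  "irreducible_mat A \<longleftrightarrow> square_mat A \<and> \<not> reducible_mat A"


section \<open>The forward Gauss-Seidel scheme\<close>

text \<open>\<open>mat_inverse\<close> returns an option, which is \<open>None\<close> on singular matrices; below, \<open>mat_inv\<close>
  is only applied to triangular matrices with nonzero diagonal.\<close>

abbreviation mat_inv :: "complex mat \<Rightarrow> complex mat" where
  "mat_inv A \<equiv> the (mat_inverse A)"

definition diag_part :: "complex mat \<Rightarrow> complex mat" where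
  "diag_part A = mat_diag (dim_row A) (\<lambda>i. A $$ (i,i))"

text \<open>The signs of the triangular parts are chosen so that \<open>A = D\<^sub>A - L\<^sub>A - U\<^sub>A\<close>.\<close>

definition lower_part :: "complex mat \<Rightarrow> complex mat" where
  "lower_part A = mat (dim_row A) (dim_col A) (\<lambda>(i,j). if j < i then - A $$ (i,j) else 0)"

definition upper_part :: "complex mat \<Rightarrow> complex mat" where
  "upper_part A = mat (dim_row A) (dim_col A) (\<lambda>(i,j). if i < j then - A $$ (i,j) else 0)"

lemma splitting:
  assumes "A \<in> carrier_mat n n"
  shows "A = diag_part A - lower_part A - upper_part A"
  using assms
  by (intro eq_matI) (auto simp: diag_part_def lower_part_def upper_part_def mat_diag_def)

lemma mat_inv_inverts:
  assumes A: "A \<in> carrier_mat n n" and det: "det A \<noteq> 0"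
  shows "mat_inv A \<in> carrier_mat n n" "A * mat_inv A = 1\<^sub>m n" "mat_inv A * A = 1\<^sub>m n"
proof -
  have "A \<in> Units (ring_mat TYPE(complex) n ())"
    using det_non_zero_imp_unit[OF A det] .
  then obtain B where "mat_inverse A = Some B"
    using mat_inverse(1)[OF A, of "()"] by (cases "mat_inverse A") auto
  then show "mat_inv A \<in> carrier_mat n n" "A * mat_inv A = 1\<^sub>m n" "mat_inv A * A = 1\<^sub>m n"
    using mat_inverse(2)[OF A] by auto
qed

lemma det_diag_minus_lower:
  assumes A: "A \<in> carrier_mat n n"
  shows "det (diag_part A - lower_part A) = (\<Prod>i<n. A $$ (i,i))"
proof -
  let ?M = "diag_part A - lower_part A"
  have M: "?M \<in> carrier_mat n n"
    using A by (auto simp: diag_part_def lower_part_def)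
  have "det ?M = prod_list (diag_mat ?M)"
    by (rule det_lower_triangular[OF _ M])
       (use A in \<open>auto simp: diag_part_def lower_part_def mat_diag_def\<close>)
  also have "\<dots> = (\<Prod>i<n. ?M $$ (i,i))"
    using carrier_matD[OF M]
    by (simp add: prod_list_diag_prod atLeast0LessThan del: index_minus_mat)
  also have "\<dots> = (\<Prod>i<n. A $$ (i,i))"
    using A by (intro prod.cong) (auto simp: diag_part_def lower_part_def mat_diag_def)
  finally show ?thesis .
qed

definition H_FGS :: "complex mat \<Rightarrow> complex mat" where
  "H_FGS A = mat_inv (diag_part A - lower_part A) * upper_part A"

primrec fgs_iter :: "complex mat \<Rightarrow> complex vec \<Rightarrow> complex vec \<Rightarrow> nat \<Rightarrow> complex vec" where
  "fgs_iter A b x0 0 = x0"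
| "fgs_iter A b x0 (Suc k) =
     H_FGS A *\<^sub>v fgs_iter A b x0 k + mat_inv (diag_part A - lower_part A) *\<^sub>v b"

definition vec_tendsto :: "nat \<Rightarrow> (nat \<Rightarrow> complex vec) \<Rightarrow> complex vec \<Rightarrow> bool" where
  "vec_tendsto n X y \<longleftrightarrow> (\<forall>i<n. (\<lambda>k. X k $ i) \<longlonglongrightarrow> y $ i)"

definition fgs_converges :: "nat \<Rightarrow> complex mat \<Rightarrow> complex vec \<Rightarrow> bool" where
  "fgs_converges n A b \<longleftrightarrow> (\<exists>y\<in>carrier_vec n.
     A *\<^sub>v y = b \<and> (\<forall>z\<in>carrier_vec n. A *\<^sub>v z = b \<longrightarrow> z = y) \<and>
     (\<forall>x0\<in>carrier_vec n. vec_tendsto n (fgs_iter A b x0) y))"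


section \<open>Ray patterns\<close>

text \<open>\<open>\<theta> r s\<close> is the argument \<open>\<psi>\<^sub>r\<^sub>s\<close>. The diagonal condition is read modulo \<open>2\<pi>\<close> like the
  others; this does not change the resulting matrices \<open>(exp (\<i> \<psi>\<^sub>r\<^sub>s))\<close>.\<close>

definition ray_pattern :: "nat \<Rightarrow> real \<Rightarrow> (nat \<Rightarrow> nat \<Rightarrow> real) \<Rightarrow> bool" where
  "ray_pattern k \<psi> \<theta> \<longleftrightarrow>
     (\<forall>r<k. \<forall>s<k. r \<noteq> s \<longrightarrow> [\<theta> r s + \<theta> s r = \<psi>] (rmod (2*pi))) \<and>
     (\<forall>r<k. \<forall>s<k. \<forall>t<k. (r < s \<and> s < t) \<or> (s < t \<and> t < r) \<or> (t < r \<and> r < s) \<longrightarrow>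
        [\<theta> r s - \<theta> r t = \<theta> t s + pi] (rmod (2*pi))) \<and>
     (\<forall>r<k. \<forall>s<k. \<forall>t<k. (r < t \<and> t < s) \<or> (t < s \<and> s < r) \<or> (s < r \<and> r < t) \<longrightarrow>
        [\<theta> r s - \<theta> r t = \<theta> t s - \<psi> + pi] (rmod (2*pi))) \<and>
     (\<forall>r<k. [\<theta> r r = 0] (rmod (2*pi)))"

definition ray_pattern_mat :: "nat \<Rightarrow> real \<Rightarrow> complex mat \<Rightarrow> bool" where
  "ray_pattern_mat k \<psi> M \<longleftrightarrow>
     (\<exists>\<theta>. ray_pattern k \<psi> \<theta> \<and> M = mat k k (\<lambda>(r,s). exp (\<i> * of_real (\<theta> r s))))"

definition U_mats :: "real \<Rightarrow> nat \<Rightarrow> complex mat set" where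
  "U_mats \<psi> k = {B \<in> carrier_mat k k. \<exists>(\<eta>::real) M. ray_pattern_mat k \<psi> M \<and>
     (\<forall>r<k. \<forall>s<k. B $$ (r,s) = exp (\<i> * of_real \<eta>) * of_real (cmod (B $$ (r,s))) * M $$ (r,s))}"

end

theory Submission
  imports Defs
begin

text \<open>
  A number \<open>\<mu>\<close> is an eigenvalue of \<open>H\<^sub>F\<^sub>G\<^sub>S\<close> iff the pencil \<open>\<mu> (D - L) - U\<close> is singular; its entries
  are \<open>a\<^sub>i\<^sub>j\<close> for \<open>i < j\<close> and \<open>\<mu> a\<^sub>i\<^sub>j\<close> otherwise. Let \<open>\<alpha>\<close> be weights witnessing dominance.
  If \<open>\<bar>\<mu>\<bar> \<ge> 1\<close> and \<open>v\<close> is a kernel vector, then every row \<open>i\<close> at which \<open>\<bar>v\<^sub>i\<bar> / \<alpha>\<^sub>i\<close> is maximal forces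
  equality in the triangle inequality. Hence the set of these indices is closed under \<open>a\<^sub>i\<^sub>j \<noteq> 0\<close>,
  and a minimal closed subset \<open>K\<close> yields an irreducible equipotent principal submatrix. Its first
  row has a nonzero entry right of the diagonal, which forces \<open>\<bar>\<mu>\<bar> = 1\<close>. With \<open>u\<^sub>i = v\<^sub>i / \<bar>v\<^sub>i\<bar>\<close>, the
  phases of \<open>a\<^sub>i\<^sub>j / a\<^sub>i\<^sub>i\<close> are \<open>- (u\<^sub>i / u\<^sub>j) \<mu>\<close> above and \<open>- (u\<^sub>i / u\<^sub>j)\<close> below the diagonal, and this is
  exactly the general form of a \<open>\<psi>\<close>-ray pattern with \<open>\<mu> = e\<^sup>i\<^sup>\<psi>\<close>.

  Conversely, such phases on an irreducible submatrix with equipotency weights \<open>\<beta>\<close> make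
  \<open>\<beta>\<^sub>i u\<^sub>i\<close> a kernel vector of the pencil of the submatrix. The indices minimising \<open>\<alpha>\<^sub>i / \<beta>\<^sub>i\<close> form a
  closed set, so by irreducibility \<open>\<alpha>\<close> and \<open>\<beta>\<close> are proportional on the submatrix, whose rows then
  vanish outside of it; therefore the pencil of \<open>A\<close> is block triangular and singular.
\<close>

section \<open>The pencil of the iteration matrix\<close>

definition fgs_pencil :: "complex mat \<Rightarrow> complex \<Rightarrow> complex mat" where
  "fgs_pencil A \<mu> = mat (dim_row A) (dim_col A) (\<lambda>(i,j). (if i < j then 1 else \<mu>) * A $$ (i,j))"

lemma fgs_pencil_carrier [simp]: "A \<in> carrier_mat n n \<Longrightarrow> fgs_pencil A \<mu> \<in> carrier_mat n n"
  by (auto simp: fgs_pencil_def)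

lemma fgs_pencil_eq:
  assumes "A \<in> carrier_mat n n"
  shows "fgs_pencil A \<mu> = \<mu> \<cdot>\<^sub>m (diag_part A - lower_part A) - upper_part A"
  using assms
  by (intro eq_matI)
     (auto simp: fgs_pencil_def diag_part_def lower_part_def upper_part_def mat_diag_def)

lemma fgs_pencil_one: "A \<in> carrier_mat n n \<Longrightarrow> fgs_pencil A 1 = A"
  by (intro eq_matI) (auto simp: fgs_pencil_def)

lemma fgs_pencil_mult_vec:
  assumes "A \<in> carrier_mat n n" "v \<in> carrier_vec n" "i < n"
  shows "(fgs_pencil A \<mu> *\<^sub>v v) $ i = (\<Sum>j<n. (if i < j then 1 else \<mu>) * A $$ (i,j) * v $ j)"
  using assms by (auto simp: fgs_pencil_def scalar_prod_def atLeast0LessThan)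

lemma vec_eq_iff_minus_eq_zero:
  fixes v w :: "complex vec"
  assumes "v \<in> carrier_vec n" "w \<in> carrier_vec n"
  shows "v = w \<longleftrightarrow> v - w = 0\<^sub>v n"
  using assms by (auto simp: vec_eq_iff)

lemma smult_mat_mult_vec:
  fixes B :: "complex mat"
  assumes "B \<in> carrier_mat nr nc" "v \<in> carrier_vec nc"
  shows "(c \<cdot>\<^sub>m B) *\<^sub>v v = c \<cdot>\<^sub>v (B *\<^sub>v v)"
  using assms by (intro eq_vecI) (auto simp: scalar_prod_def sum_distrib_left mult.assoc)

text \<open>Powers unfold with the new factor on the right, whereas a step of the iteration
  multiplies by the matrix on the left.\<close>

lemma pow_mat_commute:
  fixes B :: "'a :: semiring_1 mat"
  assumes B: "B \<in> carrier_mat n n"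
  shows "B ^\<^sub>m k * B = B * B ^\<^sub>m k"
proof (induction k)
  case (Suc k)
  have "B ^\<^sub>m Suc k * B = B * B ^\<^sub>m k * B"
    using Suc by simp
  then show ?case
    using assoc_mult_mat[OF B pow_carrier_mat[OF B] B] by simp
qed (use B in auto)

locale fgs =
  fixes A :: "complex mat" and n :: nat
  assumes A: "A \<in> carrier_mat n n"
    and diag: "\<And>i. i < n \<Longrightarrow> A $$ (i,i) \<noteq> 0"
begin

abbreviation "M \<equiv> diag_part A - lower_part A"

lemma parts_carrier [simp]:
  "diag_part A \<in> carrier_mat n n" "lower_part A \<in> carrier_mat n n" "upper_part A \<in> carrier_mat n n"
  using A by (auto simp: diag_part_def lower_part_def upper_part_def mat_diag_def)

lemmas parts_dim [simp] = parts_carrier[THEN carrier_matD(1)] parts_carrier[THEN carrier_matD(2)]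

lemma M_carrier [simp]: "M \<in> carrier_mat n n"
  by (rule minus_carrier_mat) simp

lemma det_M: "det M \<noteq> 0"
  using det_diag_minus_lower[OF A] diag by auto

lemmas M_inv = mat_inv_inverts[OF M_carrier det_M]

lemmas M_inv_dim [simp] = carrier_matD[OF M_inv(1)]

lemma H_carrier [simp]: "H_FGS A \<in> carrier_mat n n"
  unfolding H_FGS_def using M_inv(1) by simp

lemmas H_dim [simp] = carrier_matD[OF H_carrier]

lemma M_mult_eq_iff:
  assumes "v \<in> carrier_vec n" "w \<in> carrier_vec n"
  shows "M *\<^sub>v v = w \<longleftrightarrow> v = mat_inv M *\<^sub>v w"
proof
  assume "M *\<^sub>v v = w"
  then have "mat_inv M *\<^sub>v w = mat_inv M * M *\<^sub>v v"
    using assoc_mult_mat_vec[OF M_inv(1) M_carrier assms(1)] by simp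
  then show "v = mat_inv M *\<^sub>v w"
    using assms by (simp add: M_inv(3))
next
  assume v: "v = mat_inv M *\<^sub>v w"
  have "M *\<^sub>v v = M * mat_inv M *\<^sub>v w"
    unfolding v using assoc_mult_mat_vec[OF M_carrier M_inv(1) assms(2)] by simp
  then show "M *\<^sub>v v = w"
    using assms by (simp add: M_inv(2))
qed

lemma H_mult_vec:
  "v \<in> carrier_vec n \<Longrightarrow> H_FGS A *\<^sub>v v = mat_inv M *\<^sub>v (upper_part A *\<^sub>v v)"
  unfolding H_FGS_def by (rule assoc_mult_mat_vec[OF M_inv(1) parts_carrier(3)])

text \<open>Multiplying the eigenvector equation by \<open>M\<close> removes the inverse; what
  remains is the pencil applied to \<open>v\<close>.\<close>

lemma eigenvector_H_iff:
  assumes v: "v \<in> carrier_vec n"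
  shows "H_FGS A *\<^sub>v v = \<mu> \<cdot>\<^sub>v v \<longleftrightarrow> fgs_pencil A \<mu> *\<^sub>v v = 0\<^sub>v n"
proof -
  have "H_FGS A *\<^sub>v v = \<mu> \<cdot>\<^sub>v v \<longleftrightarrow> M *\<^sub>v (\<mu> \<cdot>\<^sub>v v) = upper_part A *\<^sub>v v"
    using v M_mult_eq_iff[of "\<mu> \<cdot>\<^sub>v v" "upper_part A *\<^sub>v v"] H_mult_vec[OF v]
    by (auto simp: mult_mat_vec_carrier[where nr = n and n = n])
  also have "\<dots> \<longleftrightarrow> \<mu> \<cdot>\<^sub>m M *\<^sub>v v = upper_part A *\<^sub>v v"
    using v by (simp add: smult_mat_mult_vec[OF M_carrier v] mult_mat_vec[OF M_carrier v])
  also have "\<dots> \<longleftrightarrow> \<mu> \<cdot>\<^sub>m M *\<^sub>v v - upper_part A *\<^sub>v v = 0\<^sub>v n"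
  proof -
    have "\<mu> \<cdot>\<^sub>m M *\<^sub>v v \<in> carrier_vec n" "upper_part A *\<^sub>v v \<in> carrier_vec n"
      using v by (auto intro!: mult_mat_vec_carrier[where nr = n and n = n])
    then show ?thesis by (rule vec_eq_iff_minus_eq_zero)
  qed
  also have "\<mu> \<cdot>\<^sub>m M *\<^sub>v v - upper_part A *\<^sub>v v = fgs_pencil A \<mu> *\<^sub>v v"
    unfolding fgs_pencil_eq[OF A] using v
    by (intro minus_mult_distrib_mat_vec[symmetric, where nr = n and nc = n]) auto
  finally show ?thesis .
qed

lemma eigenvalue_H_iff: "eigenvalue (H_FGS A) \<mu> \<longleftrightarrow> det (fgs_pencil A \<mu>) = 0"
  unfolding eigenvalue_def eigenvector_def det_0_iff_vec_prod_zero[OF fgs_pencil_carrier[OF A]]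
  using eigenvector_H_iff H_dim by auto

end

section \<open>Convergence of the scheme\<close>

text \<open>For \<open>n > 0\<close> the spectrum is finite and nonempty, so the spectral radius is
  an attained maximum.\<close>

lemma spectral_radius_less_iff:
  assumes "H \<in> carrier_mat n n" "n > 0"
  shows "spectral_radius H < r \<longleftrightarrow> (\<forall>\<mu>. eigenvalue H \<mu> \<longrightarrow> cmod \<mu> < r)"
  using spectral_radius_mem_max[OF assms] unfolding spectrum_def by force

text \<open>Choose \<open>r\<close> strictly between the spectral radius and 1. Then
  \<open>G = H / r\<close> still has spectral radius below 1, so its powers stay bounded by the
  Jordan normal form, and \<open>H^k = r^k G^k\<close> decays geometrically.\<close>

lemma pow_mat_tendsto_zero:
  fixes H :: "complex mat"
  assumes H: "H \<in> carrier_mat n n" and n: "n > 0" and sr: "spectral_radius H < 1"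
    and ij: "i < n" "j < n"
  shows "(\<lambda>k. (H ^\<^sub>m k) $$ (i,j)) \<longlonglongrightarrow> 0"
proof -
  have "0 \<le> spectral_radius H"
    using spectral_radius_mem_max(1)[OF H n] by auto
  then obtain r where r: "0 < r" "r < 1" "spectral_radius H < r"
    using dense[OF sr] by auto
  let ?c = "complex_of_real r"
  define G where "G = inverse ?c \<cdot>\<^sub>m H"
  have G: "G \<in> carrier_mat n n"
    using H by (simp add: G_def)
  have HG: "H = ?c \<cdot>\<^sub>m G"
    using r by (auto simp: G_def)
  have pow: "H ^\<^sub>m k = ?c ^ k \<cdot>\<^sub>m (G ^\<^sub>m k)" for k
  proof (induction k)
    case 0
    then show ?case using H G by (auto intro!: eq_matI)
  next
    case (Suc k)
    have Gk: "G ^\<^sub>m k \<in> carrier_mat n n"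
      using G by simp
    have "H ^\<^sub>m Suc k = (?c ^ k \<cdot>\<^sub>m (G ^\<^sub>m k)) * (?c \<cdot>\<^sub>m G)"
      by (simp add: Suc) (simp add: HG)
    also have "\<dots> = ?c ^ k \<cdot>\<^sub>m (?c \<cdot>\<^sub>m (G ^\<^sub>m k * G))"
      using mult_smult_assoc_mat[OF Gk, of "?c \<cdot>\<^sub>m G" n "?c ^ k"] mult_smult_distrib[OF Gk G] G by simp
    also have "\<dots> = ?c ^ Suc k \<cdot>\<^sub>m (G ^\<^sub>m Suc k)"
      by (intro eq_matI) auto
    finally show ?case .
  qed
  have "spectral_radius G < 1"
    unfolding spectral_radius_less_iff[OF G n]
  proof (intro allI impI)
    fix \<nu> assume "eigenvalue G \<nu>"
    then obtain v where v: "v \<in> carrier_vec n" "v \<noteq> 0\<^sub>v n" "G *\<^sub>v v = \<nu> \<cdot>\<^sub>v v"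
      using G by (auto simp: eigenvalue_def eigenvector_def)
    then have "H *\<^sub>v v = (?c * \<nu>) \<cdot>\<^sub>v v"
      using G by (simp add: HG smult_mat_mult_vec[OF G] smult_smult_assoc)
    then have "eigenvalue H (?c * \<nu>)"
      using v H by (auto simp: eigenvalue_def eigenvector_def)
    then have "cmod (?c * \<nu>) < r"
      using r(3) spectral_radius_less_iff[OF H n] by blast
    then show "cmod \<nu> < 1"
      using r(1) by (simp add: norm_mult)
  qed
  then obtain b where "\<And>k. norm_bound (G ^\<^sub>m k) b"
    using spectral_radius_jnf_norm_bound_less_1_upper_triangular[OF G] by blast
  then have b: "cmod ((G ^\<^sub>m k) $$ (i,j)) \<le> b" for k
    using ij carrier_matD[OF pow_carrier_mat[OF G, of k]] unfolding norm_bound_def by auto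
  have le: "cmod ((H ^\<^sub>m k) $$ (i,j)) \<le> norm (r ^ k) * b" for k
  proof -
    have "(H ^\<^sub>m k) $$ (i,j) = ?c ^ k * (G ^\<^sub>m k) $$ (i,j)"
      unfolding pow using ij carrier_matD[OF pow_carrier_mat[OF G, of k]] by simp
    then show ?thesis
      using b[of k] r(1) by (simp add: norm_mult norm_power mult_left_mono)
  qed
  have "(\<lambda>k. r ^ k) \<longlonglongrightarrow> 0"
    using r by (intro LIMSEQ_power_zero) auto
  then show ?thesis
    by (rule tendsto_0_le) (rule always_eventually, rule allI, rule le)
qed

section \<open>Error of the iteration and its limit\<close>

context fgs
begin

text \<open>By the splitting, \<open>A y = b\<close> says \<open>M y = U y + b\<close>; applying the
  inverse of \<open>M\<close> gives the fixed-point equation.\<close>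

lemma fgs_fixed_point:
  assumes y: "y \<in> carrier_vec n" and b: "b \<in> carrier_vec n" and Ay: "A *\<^sub>v y = b"
  shows "H_FGS A *\<^sub>v y + mat_inv M *\<^sub>v b = y"
proof -
  have U: "upper_part A *\<^sub>v y \<in> carrier_vec n" and My: "M *\<^sub>v y \<in> carrier_vec n"
    using y by (auto intro!: mult_mat_vec_carrier[where nr = n and n = n])
  have "b = M *\<^sub>v y - upper_part A *\<^sub>v y"
    using minus_mult_distrib_mat_vec[OF M_carrier parts_carrier(3) y] splitting[OF A] Ay by simp
  then have "M *\<^sub>v y = upper_part A *\<^sub>v y + b"
    using U My b by (intro eq_vecI) auto
  then have "y = mat_inv M *\<^sub>v (upper_part A *\<^sub>v y + b)"
    using M_mult_eq_iff[OF y] U b by simp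
  also have "\<dots> = H_FGS A *\<^sub>v y + mat_inv M *\<^sub>v b"
    using mult_add_distrib_mat_vec[OF M_inv(1) U b] H_mult_vec[OF y] by simp
  finally show ?thesis by simp
qed

text \<open>The step is affine with fixed point \<open>y\<close>, so the error evolves linearly:
  each step multiplies it by \<open>H_FGS A\<close>. Every initial guess has the form
  \<open>y + e\<close>.\<close>

lemma fgs_iter_error:
  assumes y: "y \<in> carrier_vec n" and b: "b \<in> carrier_vec n" and Ay: "A *\<^sub>v y = b"
    and e: "e \<in> carrier_vec n"
  shows "fgs_iter A b (y + e) k = y + H_FGS A ^\<^sub>m k *\<^sub>v e"
proof (induction k)
  case 0
  then show ?case using e H_dim by simp
next
  case (Suc k)
  have Hk: "H_FGS A ^\<^sub>m k *\<^sub>v e \<in> carrier_vec n"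
    using e by (intro mult_mat_vec_carrier[where nr = n and n = n]) auto
  have c: "mat_inv M *\<^sub>v b \<in> carrier_vec n" and Hy: "H_FGS A *\<^sub>v y \<in> carrier_vec n"
    using b y M_inv(1) by (auto intro!: mult_mat_vec_carrier[where nr = n and n = n])
  have HHk: "H_FGS A *\<^sub>v (H_FGS A ^\<^sub>m k *\<^sub>v e) \<in> carrier_vec n"
    by (rule mult_mat_vec_carrier[OF H_carrier Hk])
  have "fgs_iter A b (y + e) (Suc k) = H_FGS A *\<^sub>v (y + H_FGS A ^\<^sub>m k *\<^sub>v e) + mat_inv M *\<^sub>v b"
    using Suc by simp
  also have "\<dots> = H_FGS A *\<^sub>v y + H_FGS A *\<^sub>v (H_FGS A ^\<^sub>m k *\<^sub>v e) + mat_inv M *\<^sub>v b"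
    using mult_add_distrib_mat_vec[OF H_carrier y Hk] by simp
  also have "\<dots> = (H_FGS A *\<^sub>v y + mat_inv M *\<^sub>v b) + H_FGS A *\<^sub>v (H_FGS A ^\<^sub>m k *\<^sub>v e)"
    using Hy HHk c by (auto simp: vec_eq_iff)
  also have "\<dots> = y + H_FGS A *\<^sub>v (H_FGS A ^\<^sub>m k *\<^sub>v e)"
    using fgs_fixed_point[OF y b Ay] by simp
  also have "H_FGS A *\<^sub>v (H_FGS A ^\<^sub>m k *\<^sub>v e) = H_FGS A ^\<^sub>m Suc k *\<^sub>v e"
    using pow_mat_commute[OF H_carrier, of k]
      assoc_mult_mat_vec[OF H_carrier pow_carrier_mat[OF H_carrier] e, of k] e by simp
  finally show ?case .
qed

text \<open>Convergence for a single \<open>b\<close> already controls the whole spectrum, because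
  the initial guess may deviate from the solution by any eigenvector.\<close>

lemma fgs_converges_iff:
  assumes n: "n > 0" and b: "b \<in> carrier_vec n"
  shows "fgs_converges n A b \<longleftrightarrow> spectral_radius (H_FGS A) < 1"
proof
  assume sr: "spectral_radius (H_FGS A) < 1"
  \<comment> \<open>At \<open>\<mu> = 1\<close> the pencil is \<open>A\<close> itself, so excluding
    the eigenvalue 1 gives unique solvability.\<close>
  have "\<not> eigenvalue (H_FGS A) 1"
    using sr spectral_radius_less_iff[OF H_carrier n] by force
  then have det: "det A \<noteq> 0"
    using eigenvalue_H_iff[of 1] fgs_pencil_one[OF A] by simp
  note Ainv = mat_inv_inverts[OF A det]
  define y where "y = mat_inv A *\<^sub>v b"
  have y: "y \<in> carrier_vec n"
    using Ainv(1) b unfolding y_def by (intro mult_mat_vec_carrier[where nr = n and n = n])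
  have Ay: "A *\<^sub>v y = b"
    using assoc_mult_mat_vec[OF A Ainv(1) b] Ainv(2) b by (simp add: y_def)
  have uniq: "z = y" if z: "z \<in> carrier_vec n" "A *\<^sub>v z = b" for z
    using assoc_mult_mat_vec[OF Ainv(1) A z(1)] Ainv(3) z by (simp add: y_def)
  have lim: "vec_tendsto n (fgs_iter A b x0) y" if x0: "x0 \<in> carrier_vec n" for x0
  proof -
    define e where "e = x0 - y"
    have e: "e \<in> carrier_vec n" and x0e: "x0 = y + e"
      using x0 y by (auto simp: e_def vec_eq_iff)
    show ?thesis
      unfolding vec_tendsto_def
    proof (intro allI impI)
      fix i assume i: "i < n"
      have "(\<lambda>k. y $ i + (\<Sum>j<n. (H_FGS A ^\<^sub>m k) $$ (i,j) * e $ j)) \<longlonglongrightarrow> y $ i + (\<Sum>j<n. 0 * e $ j)"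
        using i by (intro tendsto_intros pow_mat_tendsto_zero[OF H_carrier n sr]) auto
      moreover have "fgs_iter A b x0 k $ i = y $ i + (\<Sum>j<n. (H_FGS A ^\<^sub>m k) $$ (i,j) * e $ j)" for k
        unfolding x0e fgs_iter_error[OF y b Ay e]
        using i e carrier_matD[OF pow_carrier_mat[OF H_carrier, of k]]
        by (auto simp: scalar_prod_def atLeast0LessThan)
      ultimately show "(\<lambda>k. fgs_iter A b x0 k $ i) \<longlonglongrightarrow> y $ i"
        by simp
    qed
  qed
  show "fgs_converges n A b"
    unfolding fgs_converges_def using y Ay uniq lim by blast
next
  assume "fgs_converges n A b"
  then obtain y where y: "y \<in> carrier_vec n" and Ay: "A *\<^sub>v y = b"
    and lim: "\<And>x0. x0 \<in> carrier_vec n \<Longrightarrow> vec_tendsto n (fgs_iter A b x0) y"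
    unfolding fgs_converges_def by blast
  show "spectral_radius (H_FGS A) < 1"
    unfolding spectral_radius_less_iff[OF H_carrier n]
  proof (intro allI impI)
    fix \<mu> assume "eigenvalue (H_FGS A) \<mu>"
    then obtain v where ev: "eigenvector (H_FGS A) v \<mu>"
      by (auto simp: eigenvalue_def)
    then have v: "v \<in> carrier_vec n" "v \<noteq> 0\<^sub>v n"
      using H_dim by (auto simp: eigenvector_def)
    then obtain i where i: "i < n" "v $ i \<noteq> 0"
      by (auto simp: vec_eq_iff)
    \<comment> \<open>Started at \<open>y + v\<close>, the scheme has error \<open>\<mu> ^ k\<close>
      times \<open>v\<close>; a nonzero component of \<open>v\<close> then isolates
      \<open>\<mu> ^ k\<close>.\<close>
    have "fgs_iter A b (y + v) = (\<lambda>k. y + \<mu> ^ k \<cdot>\<^sub>v v)"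
      using fgs_iter_error[OF y b Ay v(1)] eigenvector_pow[OF H_carrier ev] by auto
    then have "vec_tendsto n (\<lambda>k. y + \<mu> ^ k \<cdot>\<^sub>v v) y"
      using lim[of "y + v"] y v by simp
    then have "(\<lambda>k. y $ i + \<mu> ^ k * v $ i) \<longlonglongrightarrow> y $ i"
      using i v y by (auto simp: vec_tendsto_def)
    then have "(\<lambda>k. (y $ i + \<mu> ^ k * v $ i - y $ i) / v $ i) \<longlonglongrightarrow> (y $ i - y $ i) / v $ i"
      using i by (intro tendsto_intros) auto
    then have "(\<lambda>k. \<mu> ^ k) \<longlonglongrightarrow> 0"
      using i by simp
    then have "(\<lambda>k. cmod \<mu> ^ k) \<longlonglongrightarrow> 0"
      using tendsto_norm_zero by (force simp: norm_power)
    from LIMSEQ_le_const[OF this, of 1] show "cmod \<mu> < 1"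
      using one_le_power[of "cmod \<mu>"] by (cases "cmod \<mu> < 1") auto
  qed
qed

end

section \<open>Principal submatrices\<close>

text \<open>Trades permutations for index sets: the images of the positions \<open>m..<k\<close>
  form a set whose rows vanish outside of it; conversely, listing the complement of such a set first
  yields a reducing permutation.\<close>

lemma irreducible_mat_iff:
  assumes B: "B \<in> carrier_mat k k"
  shows "irreducible_mat B \<longleftrightarrow>
    (\<forall>S\<subseteq>{..<k}. S \<noteq> {} \<and> (\<forall>i\<in>S. \<forall>j\<in>{..<k} - S. B $$ (i,j) = 0) \<longrightarrow> S = {..<k})"
    (is "_ \<longleftrightarrow> (\<forall>S\<subseteq>{..<k}. ?C S \<longrightarrow> S = {..<k})")
proof -
  have "reducible_mat B \<longleftrightarrow> (\<exists>S\<subseteq>{..<k}. ?C S \<and> S \<noteq> {..<k})"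
  proof
    assume "reducible_mat B"
    then obtain p m where p: "p permutes {..<k}" and m: "0 < m" "m < k"
      and z: "\<And>i j. m \<le> i \<Longrightarrow> i < k \<Longrightarrow> j < m \<Longrightarrow> B $$ (p i, p j) = 0"
      using B unfolding reducible_mat_def by auto
    have im: "p ` {..<k} = {..<k}" and inj: "inj p"
      using p by (simp_all add: permutes_image permutes_inj)
    have compl: "{..<k} - p ` {m..<k} = p ` {..<m}"
    proof -
      have "{..<k} - p ` {m..<k} = p ` ({..<k} - {m..<k})"
        using im by (simp add: image_set_diff[OF inj])
      also have "{..<k} - {m..<k} = {..<m}"
        using m by auto
      finally show ?thesis .
    qed
    have sub: "p ` {m..<k} \<subseteq> {..<k}"
      using im by (metis atLeastLessThan_iff image_mono lessThan_iff subsetI)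
    have "p ` {..<m} \<noteq> {}" "p ` {m..<k} \<noteq> {}"
      using m by auto
    moreover have "\<forall>i\<in>p ` {m..<k}. \<forall>j\<in>{..<k} - p ` {m..<k}. B $$ (i,j) = 0"
      unfolding compl using z by auto
    ultimately show "\<exists>S\<subseteq>{..<k}. ?C S \<and> S \<noteq> {..<k}"
      using sub compl by (intro exI[of _ "p ` {m..<k}"]) auto
  next
    assume "\<exists>S\<subseteq>{..<k}. ?C S \<and> S \<noteq> {..<k}"
    then obtain S where S: "S \<subseteq> {..<k}" "S \<noteq> {}" "S \<noteq> {..<k}"
      and z: "\<And>i j. i \<in> S \<Longrightarrow> j \<in> {..<k} - S \<Longrightarrow> B $$ (i,j) = 0"
      by auto
    have fS: "finite S"
      using S(1) finite_subset by blast
    define m where "m = card ({..<k} - S)"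
    have cS: "card S = k - m"
      using S(1) fS card_mono[OF _ S(1)] by (simp add: m_def card_Diff_subset)
    have m: "0 < m" "m < k"
      using S fS card_mono[OF _ S(1)] card_subset_eq[of "{..<k}" S] card_gt_0_iff[of S]
      by (auto simp: m_def card_Diff_subset)
    obtain f where f: "bij_betw f {..<m} ({..<k} - S)"
      using finite_same_card_bij[of "{..<m}" "{..<k} - S"] by (auto simp: m_def)
    obtain g where g: "bij_betw g {m..<k} S"
      using finite_same_card_bij[of "{m..<k}" S] cS fS by auto
    \<comment> \<open>\<open>p\<close> lists the complement of \<open>S\<close> first and then
      \<open>S\<close>; beyond \<open>k\<close> it is the identity, as \<open>permutes\<close>
      demands.\<close>
    define p where "p i = (if i < m then f i else if i < k then g i else i)" for i
    have pf: "bij_betw p {..<m} ({..<k} - S)"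
      using f by (subst bij_betw_cong[where g = f]) (auto simp: p_def)
    have pg: "bij_betw p {m..<k} S"
      using g by (subst bij_betw_cong[where g = g]) (auto simp: p_def)
    have "bij_betw p ({..<m} \<union> {m..<k}) (({..<k} - S) \<union> S)"
      using pf pg by (rule bij_betw_combine) auto
    moreover have "{..<m} \<union> {m..<k} = {..<k}" "({..<k} - S) \<union> S = {..<k}"
      using m S(1) by auto
    ultimately have "bij_betw p {..<k} {..<k}"
      by simp
    then have "p permutes {..<k}"
      by (rule bij_imp_permutes) (use m in \<open>auto simp: p_def\<close>)
    moreover have "B $$ (p i, p j) = 0" if "m \<le> i" "i < k" "j < m" for i j
      using z bij_betwE[OF pf] bij_betwE[OF pg] that by auto
    ultimately show "reducible_mat B"
      using m B unfolding reducible_mat_def by auto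
  qed
  moreover have "square_mat B"
    using B by simp
  ultimately have "irreducible_mat B \<longleftrightarrow> \<not> (\<exists>S\<subseteq>{..<k}. ?C S \<and> S \<noteq> {..<k})"
    unfolding irreducible_mat_def by simp
  also have "\<dots> \<longleftrightarrow> (\<forall>S\<subseteq>{..<k}. ?C S \<longrightarrow> S = {..<k})"
    by blast
  finally show ?thesis .
qed

context
  fixes A :: "'a mat" and n :: nat and I :: "nat set"
  assumes A: "A \<in> carrier_mat n n" and I: "I \<subseteq> {..<n}"
begin

private lemma sel: "{i. i < dim_row A \<and> i \<in> I} = I" "{i. i < dim_col A \<and> i \<in> I} = I"
  using A I by auto

lemma principal_submatrix_carrier: "submatrix A I I \<in> carrier_mat (card I) (card I)"
  using dim_submatrix[of A I I] unfolding sel by blast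

lemma principal_submatrix_index:
  "r < card I \<Longrightarrow> s < card I \<Longrightarrow> submatrix A I I $$ (r,s) = A $$ (pick I r, pick I s)"
  using submatrix_index[of r A I s I] unfolding sel by blast

end

text \<open>The pencil and the ray phases treat entries above and below the diagonal differently, so
  passing to a principal submatrix must keep the order of the indices in both directions.\<close>

lemma pick_less_iff:
  assumes "r < card I" "s < card I"
  shows "pick I r < pick I s \<longleftrightarrow> r < s"
  using pick_mono_le[of s I r] pick_mono_le[of r I s] assms by (cases r s rule: linorder_cases) auto

lemma bij_betw_pick:
  assumes "finite I"
  shows "bij_betw (pick I) {..<card I} I"
proof -
  have inj: "inj_on (pick I) {..<card I}"
    by (rule inj_onI) (metis lessThan_iff less_irrefl linorder_neqE_nat pick_less_iff)
  have "pick I ` {..<card I} \<subseteq> I"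
    using pick_in_set_le by auto
  then have "pick I ` {..<card I} = I"
    using assms inj by (intro card_subset_eq) (auto simp: card_image)
  with inj show ?thesis
    by (simp add: bij_betw_def)
qed

text \<open>The rows in \<open>I\<close> vanish outside \<open>I\<close>, so a left null vector of
  the submatrix, extended by zero, is a left null vector of \<open>P\<close>. This is why the
  argument runs through the transpose.\<close>

lemma det_eq_0_of_closed_principal_submatrix:
  fixes P :: "complex mat"
  assumes P: "P \<in> carrier_mat n n" and I: "I \<subseteq> {..<n}"
    and closed: "\<And>i j. i \<in> I \<Longrightarrow> j \<in> {..<n} - I \<Longrightarrow> P $$ (i,j) = 0"
    and det: "det (submatrix P I I) = 0"
  shows "det P = 0"
proof -
  let ?k = "card I" and ?e = "pick I"
  have fin: "finite I"
    using I finite_subset by blast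
  note e = bij_betw_pick[OF fin]
  note Q = principal_submatrix_carrier[OF P I] and Qi = principal_submatrix_index[OF P I]
  obtain w where w: "w \<in> carrier_vec ?k" "w \<noteq> 0\<^sub>v ?k" "(submatrix P I I)\<^sup>T *\<^sub>v w = 0\<^sub>v ?k"
    using det det_transpose[OF Q] det_0_iff_vec_prod_zero[of "(submatrix P I I)\<^sup>T" ?k] Q by auto
  define f where "f = inv_into {..<?k} ?e"
  have f: "f (?e r) = r" if "r < ?k" for r
    using that e by (simp add: f_def bij_betw_inv_into_left)
  have eI: "?e r \<in> I" "?e r < n" if "r < ?k" for r
    using bij_betwE[OF e] I that by auto
  define x where "x = vec n (\<lambda>j. if j \<in> I then w $ (f j) else 0)"
  have x: "x \<in> carrier_vec n"
    by (simp add: x_def)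
  have sum: "(\<Sum>i<n. P $$ (i,j) * x $ i) = (\<Sum>r<?k. P $$ (?e r, j) * w $ r)" for j
  proof -
    have "(\<Sum>i<n. P $$ (i,j) * x $ i) = (\<Sum>i\<in>I. P $$ (i,j) * w $ (f i))"
      using I by (intro sum.mono_neutral_cong_right) (auto simp: x_def)
    also have "\<dots> = (\<Sum>r<?k. P $$ (?e r, j) * w $ (f (?e r)))"
      by (rule sum.reindex_bij_betw[OF e, symmetric])
    finally show ?thesis
      by (simp add: f)
  qed
  have "P\<^sup>T *\<^sub>v x = 0\<^sub>v n"
  proof (rule eq_vecI)
    fix j assume "j < dim_vec (0\<^sub>v n :: complex vec)"
    then have j: "j < n" by simp
    have "(P\<^sup>T *\<^sub>v x) $ j = (\<Sum>r<?k. P $$ (?e r, j) * w $ r)"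
      using P j x sum[of j] by (auto simp: scalar_prod_def atLeast0LessThan)
    also have "\<dots> = 0"
    proof (cases "j \<in> I")
      case True
      then obtain s where s: "s < ?k" "j = ?e s"
        using e by (auto simp: bij_betw_def)
      have "(\<Sum>r<?k. P $$ (?e r, j) * w $ r) = ((submatrix P I I)\<^sup>T *\<^sub>v w) $ s"
        using Q s w(1) by (auto simp: scalar_prod_def atLeast0LessThan Qi intro!: sum.cong)
      then show ?thesis
        using w(3) s by simp
    qed (use closed j eI in auto)
    finally show "(P\<^sup>T *\<^sub>v x) $ j = 0\<^sub>v n $ j"
      using j by simp
  qed (use P in auto)
  moreover have "x \<noteq> 0\<^sub>v n"
  proof
    assume "x = 0\<^sub>v n"
    have "w $ r = 0" if "r < ?k" for r
    proof -
      have "x $ ?e r = w $ r"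
        using f[OF that] eI[OF that] by (simp add: x_def)
      then show ?thesis
        using \<open>x = 0\<^sub>v n\<close> eI[OF that] by simp
    qed
    then show False
      using w by (auto simp: vec_eq_iff)
  qed
  ultimately have "det (P\<^sup>T) = 0"
    using x P det_0_iff_vec_prod_zero[of "P\<^sup>T" n] by auto
  then show ?thesis
    using det_transpose[OF P] by simp
qed

lemma row_scaled_carrier_index:
  assumes B: "B \<in> carrier_mat k k" and d: "\<And>i. i < k \<Longrightarrow> B $$ (i,i) \<noteq> 0"
  defines "N \<equiv> mat_inv (diag_part B) * B"
  shows "N \<in> carrier_mat k k"
    and "\<And>i j. i < k \<Longrightarrow> j < k \<Longrightarrow> N $$ (i,j) = B $$ (i,j) / B $$ (i,i)"
proof -
  let ?D = "diag_part B"
  have D: "?D \<in> carrier_mat k k"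
    using B by (auto simp: diag_part_def mat_diag_def)
  have Dij: "?D $$ (i,j) = (if i = j then B $$ (i,i) else 0)" if "i < k" "j < k" for i j
    using that B by (auto simp: diag_part_def mat_diag_def)
  \<comment> \<open>A diagonal matrix has zero lower part, so the determinant formula for
    \<open>D - L\<close> applies to \<open>?D\<close> itself.\<close>
  have "diag_part ?D - lower_part ?D = ?D"
    using D Dij B by (intro eq_matI) (auto simp: lower_part_def diag_part_def mat_diag_def)
  then have "det ?D = (\<Prod>i<k. ?D $$ (i,i))"
    using det_diag_minus_lower[OF D] by simp
  then have "det ?D \<noteq> 0"
    using d Dij by auto
  note inv = mat_inv_inverts[OF D this]
  show N: "N \<in> carrier_mat k k"
    unfolding N_def using inv(1) B by simp
  fix i j assume ij: "i < k" "j < k"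
  have "?D * N = B"
    unfolding N_def using assoc_mult_mat[OF D inv(1) B] inv(2) B by simp
  then have "B $$ (i,j) = (?D * N) $$ (i,j)"
    by simp
  also have "\<dots> = (\<Sum>l<k. ?D $$ (i,l) * N $$ (l,j))"
    using ij carrier_matD[OF D] carrier_matD[OF N] by (simp add: scalar_prod_def atLeast0LessThan)
  also have "\<dots> = (\<Sum>l<k. if l = i then B $$ (i,i) * N $$ (i,j) else 0)"
    using ij Dij by (intro sum.cong) auto
  also have "\<dots> = B $$ (i,i) * N $$ (i,j)"
    using ij by simp
  finally show "N $$ (i,j) = B $$ (i,j) / B $$ (i,i)"
    using d[OF ij(1)] by simp
qed

section \<open>Equality in the triangle inequality\<close>

text \<open>Rotating by the conjugate of the direction \<open>u\<close> of the sum turns the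
  equality into one between the sums of \<open>Re (c j * cnj u)\<close> and of
  \<open>cmod (c j)\<close>. Termwise comparison then puts every \<open>c j\<close> on the ray
  through \<open>u\<close>. If the sum is 0, so is every term, in accordance with
  \<open>sgn 0 = 0\<close>.\<close>

lemma norm_sum_eq_sum_norm:
  fixes c :: "'a \<Rightarrow> complex"
  assumes fin: "finite T" and eq: "cmod (sum c T) = (\<Sum>j\<in>T. cmod (c j))" and j: "j \<in> T"
  shows "c j = of_real (cmod (c j)) * sgn (sum c T)"
proof (cases "sum c T = 0")
  case True
  then have "cmod (c j) = 0"
    using eq fin j by (simp add: sum_nonneg_eq_0_iff)
  then show ?thesis by simp
next
  case False
  define u where "u = sgn (sum c T)"
  have u: "cmod u = 1" "u * cnj u = 1"
    using False by (simp_all add: u_def norm_sgn complex_norm_square[symmetric])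
  have "sum c T * cnj u = of_real (cmod (sum c T))"
    using u(2) False by (simp add: u_def sgn_eq complex_norm_square[symmetric] power2_eq_square)
  then have "(\<Sum>j\<in>T. Re (c j * cnj u)) = (\<Sum>j\<in>T. cmod (c j))"
    using eq by (simp add: Re_sum[symmetric] sum_distrib_right[symmetric] del: times_complex.simps)
  moreover have le: "Re (c j * cnj u) \<le> cmod (c j)" for j
    using complex_Re_le_cmod[of "c j * cnj u"] u by (simp add: norm_mult del: times_complex.simps)
  ultimately have "Re (c j * cnj u) = cmod (c j)"
    using sum_mono_inv[of "\<lambda>j. Re (c j * cnj u)" T "\<lambda>j. cmod (c j)" j] j fin by auto
  moreover have "cmod (c j * cnj u) = cmod (c j)"
    using u by (simp add: norm_mult)
  ultimately have "c j * cnj u = of_real (cmod (c j))"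
    using cmod_power2[of "c j * cnj u"] by (simp add: complex_eq_iff del: times_complex.simps)
  then have "c j * (u * cnj u) = of_real (cmod (c j)) * u"
    by (simp add: mult_ac)
  then have "c j = of_real (cmod (c j)) * u"
    using u(2) by simp
  then show ?thesis
    unfolding u_def .
qed

text \<open>The zero equation and dominance close a cycle of inequalities from
  \<open>cmod x * cmod d\<close> through the norm of the sum, the sum of the norms and the sum of
  \<open>p j * cmod (a j)\<close> back to the start. All links are equalities, and the three
  conclusions are read off from them.\<close>

lemma dominated_row_equality:
  fixes a w :: "'a \<Rightarrow> complex"
  assumes fin: "finite T" and zero: "d * x + (\<Sum>j\<in>T. a j * w j) = 0"
    and w: "\<And>j. j \<in> T \<Longrightarrow> cmod (w j) \<le> p j"
    and dom: "(\<Sum>j\<in>T. p j * cmod (a j)) \<le> cmod x * cmod d"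
  shows "(\<Sum>j\<in>T. p j * cmod (a j)) = cmod x * cmod d"
    and "\<And>j. j \<in> T \<Longrightarrow> a j = 0 \<or> cmod (w j) = p j"
    and "\<And>j. j \<in> T \<Longrightarrow> a j * w j = - of_real (cmod (a j * w j)) * sgn (d * x)"
proof -
  have sum: "(\<Sum>j\<in>T. a j * w j) = - (d * x)"
    using zero by (simp add: eq_neg_iff_add_eq_0 add.commute)
  have le: "cmod (a j * w j) \<le> p j * cmod (a j)" if "j \<in> T" for j
    using w[OF that] by (simp add: norm_mult mult.commute[of "p j"] mult_left_mono)
  have 1: "cmod x * cmod d = cmod (\<Sum>j\<in>T. a j * w j)"
    by (simp add: sum norm_mult)
  have 2: "cmod (\<Sum>j\<in>T. a j * w j) \<le> (\<Sum>j\<in>T. cmod (a j * w j))"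
    by (rule norm_sum)
  have 3: "(\<Sum>j\<in>T. cmod (a j * w j)) \<le> (\<Sum>j\<in>T. p j * cmod (a j))"
    by (intro sum_mono le)
  show "(\<Sum>j\<in>T. p j * cmod (a j)) = cmod x * cmod d"
    using 1 2 3 dom by linarith
  have eq: "(\<Sum>j\<in>T. cmod (a j * w j)) = (\<Sum>j\<in>T. p j * cmod (a j))"
    using 1 2 3 dom by linarith
  show "a j = 0 \<or> cmod (w j) = p j" if "j \<in> T" for j
    using sum_mono_inv[OF eq le that fin] by (auto simp: norm_mult)
  have "cmod (\<Sum>j\<in>T. a j * w j) = (\<Sum>j\<in>T. cmod (a j * w j))"
    using 1 2 3 dom by linarith
  from norm_sum_eq_sum_norm[OF fin this]
  show "a j * w j = - of_real (cmod (a j * w j)) * sgn (d * x)" if "j \<in> T" for j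
    using that by (simp add: sum sgn_minus)
qed

section \<open>Ray patterns\<close>

text \<open>Solved form of the ray-pattern congruences: \<open>u\<close> is a diagonal gauge and the
  minus sign stems from the summand \<open>pi\<close>. A zero entry satisfies its equation
  trivially, so only the phases of nonzero entries are constrained.\<close>

definition ray_phases :: "nat \<Rightarrow> complex \<Rightarrow> (nat \<Rightarrow> complex) \<Rightarrow> complex mat \<Rightarrow> bool" where
  "ray_phases k \<mu> u B \<longleftrightarrow> cmod \<mu> = 1 \<and> (\<forall>r<k. cmod (u r) = 1) \<and>
     (\<forall>r<k. \<forall>s<k. r \<noteq> s \<longrightarrow>
        B $$ (r,s) = of_real (cmod (B $$ (r,s))) * (- (u r / u s) * (if r < s then \<mu> else 1)))"

text \<open>The congruences are overdetermined: row 0 fixes the gauge phases \<open>\<xi>\<close>,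
  and all other entries follow from it. The unit diagonal forces the global factor
  \<open>cis \<eta>\<close> to be 1.\<close>

lemma U_mats_iff_ray_phases:
  assumes B: "B \<in> carrier_mat k k" and one: "\<And>r. r < k \<Longrightarrow> B $$ (r,r) = 1" and k: "0 < k"
  shows "(\<exists>\<psi>. B \<in> U_mats \<psi> k) \<longleftrightarrow> (\<exists>\<mu> u. ray_phases k \<mu> u B)"
proof
  assume "\<exists>\<psi>. B \<in> U_mats \<psi> k"
  then obtain \<psi> \<eta> \<theta> where ray: "ray_pattern k \<psi> \<theta>"
    and eq': "\<And>r s. r < k \<Longrightarrow> s < k \<Longrightarrow> B $$ (r,s) = cis \<eta> * of_real (cmod (B $$ (r,s))) *
      mat k k (\<lambda>(r,s). cis (\<theta> r s)) $$ (r,s)"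
    unfolding U_mats_def ray_pattern_mat_def cis_conv_exp by blast
  have eq: "B $$ (r,s) = cis \<eta> * of_real (cmod (B $$ (r,s))) * cis (\<theta> r s)" if "r < k" "s < k" for r s
    using eq'[OF that] by (simp only: index_mat(1)[OF that] prod.case)
  have th00: "cis (\<theta> r r) = 1" if "r < k" for r
    using ray that cis_eq_iff[of "\<theta> r r" 0] by (auto simp: ray_pattern_def)
  have "cis \<eta> = 1"
    using eq[OF k k] one[OF k] th00[OF k] by simp
  \<comment> \<open>Normalised by \<open>\<xi> 0 = 0\<close>; the other values solve the desired
    formula in row 0.\<close>
  define \<xi> where "\<xi> r = (if r = 0 then 0 else pi + \<psi> - \<theta> 0 r)" for r
  have th: "[\<theta> r s = pi + \<xi> r - \<xi> s + (if r < s then \<psi> else 0)] (rmod (2*pi))"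
    if rs: "r < k" "s < k" "r \<noteq> s" for r s
  proof -
    \<comment> \<open>Row 0 holds by the choice of \<open>\<xi>\<close>, column 0 by the condition
      on opposite entries, and the rest by the two triple conditions with first index 0. The shift
      by 1 in the integer witnesses absorbs \<open>pi + pi\<close>.\<close>
    consider "r = 0" | "s = 0" | "0 < s" "s < r" | "0 < r" "r < s"
      using rs(3) by linarith
    then show ?thesis
    proof cases
      case 1
      then show ?thesis using rs by (simp add: \<xi>_def)
    next
      case 2
      have "[\<theta> r 0 + \<theta> 0 r = \<psi>] (rmod (2*pi))"
        using ray rs k 2 by (auto simp: ray_pattern_def)
      then obtain m where "\<psi> = \<theta> r 0 + \<theta> 0 r + of_int m * (2*pi)"
        by (auto simp: rcong_altdef)
      then show ?thesis
        unfolding rcong_altdef using 2 rs by (intro exI[of _ "m + 1"]) (auto simp: \<xi>_def algebra_simps)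
    next
      case 3
      then have "[\<theta> 0 s - \<theta> 0 r = \<theta> r s + pi] (rmod (2*pi))"
        using ray rs k by (simp add: ray_pattern_def)
      then obtain m where "\<theta> r s + pi = \<theta> 0 s - \<theta> 0 r + of_int m * (2*pi)"
        by (auto simp: rcong_altdef)
      then show ?thesis
        unfolding rcong_altdef using 3 rs by (intro exI[of _ "1 - m"]) (auto simp: \<xi>_def algebra_simps)
    next
      case 4
      then have "[\<theta> 0 s - \<theta> 0 r = \<theta> r s - \<psi> + pi] (rmod (2*pi))"
        using ray rs k by (simp add: ray_pattern_def)
      then obtain m where "\<theta> r s - \<psi> + pi = \<theta> 0 s - \<theta> 0 r + of_int m * (2*pi)"
        by (auto simp: rcong_altdef)
      then show ?thesis
        unfolding rcong_altdef using 4 rs by (intro exI[of _ "1 - m"]) (auto simp: \<xi>_def algebra_simps)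
    qed
  qed
  have "ray_phases k (cis \<psi>) (\<lambda>r. cis (\<xi> r)) B"
    unfolding ray_phases_def
  proof (intro conjI allI impI)
    fix r s assume rs: "r < k" "s < k" "r \<noteq> s"
    have "cis (\<theta> r s) = cis (pi + \<xi> r - \<xi> s + (if r < s then \<psi> else 0))"
      using th[OF rs] by (simp add: cis_eq_iff)
    also have "\<dots> = - (cis (\<xi> r) / cis (\<xi> s)) * (if r < s then cis \<psi> else 1)"
      by (simp add: cis_mult[symmetric] cis_divide[symmetric])
    finally have th': "cis (\<theta> r s) = - (cis (\<xi> r) / cis (\<xi> s)) * (if r < s then cis \<psi> else 1)" .
    show "B $$ (r,s) = of_real (cmod (B $$ (r,s))) *
        (- (cis (\<xi> r) / cis (\<xi> s)) * (if r < s then cis \<psi> else 1))"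
      using eq[OF rs(1,2)] by (simp only: \<open>cis \<eta> = 1\<close> th' mult_1_left)
  qed simp_all
  then show "\<exists>\<mu> u. ray_phases k \<mu> u B" by blast
next
  assume "\<exists>\<mu> u. ray_phases k \<mu> u B"
  then obtain \<mu> u where ph: "cmod \<mu> = 1" "\<And>r. r < k \<Longrightarrow> cmod (u r) = 1"
    and eq: "\<And>r s. r < k \<Longrightarrow> s < k \<Longrightarrow> r \<noteq> s \<Longrightarrow>
      B $$ (r,s) = of_real (cmod (B $$ (r,s))) * (- (u r / u s) * (if r < s then \<mu> else 1))"
    unfolding ray_phases_def by blast
  define \<psi> where "\<psi> = Arg \<mu>"
  define \<xi> where "\<xi> r = Arg (u r)" for r
  define \<theta> where "\<theta> r s = (if r = s then 0 else pi + \<xi> r - \<xi> s + (if r < s then \<psi> else 0))" for r s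
  have cis1: "cis (Arg z) = z" if "cmod z = 1" for z
    using that by (subst cis_Arg) (auto simp: sgn_eq)
  have "ray_pattern k \<psi> \<theta>"
    unfolding ray_pattern_def rcong_altdef
  proof (intro conjI allI impI)
    \<comment> \<open>Each congruence holds up to exactly one full turn made of two summands
      \<open>pi\<close>: subtracted here, added in the two triple conditions.\<close>
    fix r s :: nat assume "r \<noteq> s"
    then show "\<exists>m. \<psi> = \<theta> r s + \<theta> s r + of_int m * (2*pi)"
      by (intro exI[of _ "-1"]) (auto simp: \<theta>_def)
  next
    fix r s t :: nat assume "r < s \<and> s < t \<or> s < t \<and> t < r \<or> t < r \<and> r < s"
    then show "\<exists>m. \<theta> t s + pi = \<theta> r s - \<theta> r t + of_int m * (2*pi)"
      by (intro exI[of _ 1]) (auto simp: \<theta>_def)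
  next
    fix r s t :: nat assume "r < t \<and> t < s \<or> t < s \<and> s < r \<or> s < r \<and> r < t"
    then show "\<exists>m. \<theta> t s - \<psi> + pi = \<theta> r s - \<theta> r t + of_int m * (2*pi)"
      by (intro exI[of _ 1]) (auto simp: \<theta>_def)
  qed (auto simp: \<theta>_def intro: exI[of _ 0])
  moreover have "B $$ (r,s) = exp (\<i> * of_real 0) * of_real (cmod (B $$ (r,s))) * exp (\<i> * of_real (\<theta> r s))"
    if rs: "r < k" "s < k" for r s
  proof (cases "r = s")
    case True
    then show ?thesis using one rs by (simp add: \<theta>_def)
  next
    case False
    have "exp (\<i> * of_real (\<theta> r s)) = cis (pi + \<xi> r - \<xi> s + (if r < s then \<psi> else 0))"
      using False by (simp add: \<theta>_def cis_conv_exp)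
    also have "\<dots> = - (cis (\<xi> r) / cis (\<xi> s)) * (if r < s then cis \<psi> else 1)"
      by (simp add: cis_mult[symmetric] cis_divide[symmetric])
    also have "\<dots> = - (u r / u s) * (if r < s then \<mu> else 1)"
      using ph rs by (simp add: \<xi>_def \<psi>_def cis1)
    finally have th': "exp (\<i> * of_real (\<theta> r s)) = - (u r / u s) * (if r < s then \<mu> else 1)" .
    show ?thesis
      using eq[OF rs False] by (simp only: th' of_real_0 mult_zero_right exp_zero mult_1_left)
  qed
  ultimately have "B \<in> U_mats \<psi> k"
    unfolding U_mats_def ray_pattern_mat_def using B
    by (auto intro!: exI[of _ "0::real"] exI[of _ "mat k k (\<lambda>(r,s). exp (\<i> * of_real (\<theta> r s)))"] exI[of _ \<theta>])
  then show "\<exists>\<psi>. B \<in> U_mats \<psi> k" by blast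
qed

text \<open>Two entries meet two free parameters: the gauge \<open>u\<close> fits the entry below
  the diagonal, and then \<open>\<mu>\<close> fits the one above.\<close>

lemma ray_phases_two:
  assumes "B $$ (0,1) \<noteq> 0" "B $$ (1,0) \<noteq> 0"
  shows "\<exists>\<mu> u. ray_phases 2 \<mu> u B"
proof -
  define u where "u r = (if r = 0 then 1 else - sgn (B $$ (1,0)))" for r :: nat
  have ne: "sgn (B $$ (1,0)) \<noteq> 0"
    using assms by (simp add: sgn_zero_iff)
  have pol: "z = of_real (cmod z) * sgn z" if "z \<noteq> 0" for z
    using that by (simp add: sgn_eq)
  have "ray_phases 2 (sgn (B $$ (0,1)) * sgn (B $$ (1,0))) u B"
    unfolding ray_phases_def
  proof (intro conjI allI impI)
    fix r s :: nat assume "r < 2" "s < 2" "r \<noteq> s"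
    then have "r = 0 \<and> s = 1 \<or> r = 1 \<and> s = 0" by auto
    then show "B $$ (r,s) = of_real (cmod (B $$ (r,s))) *
        (- (u r / u s) * (if r < s then sgn (B $$ (0,1)) * sgn (B $$ (1,0)) else 1))"
      using ne pol[OF assms(1)] pol[OF assms(2)] by (elim disjE conjE) (simp_all add: u_def)
  qed (use assms in \<open>auto simp: u_def norm_mult norm_sgn\<close>)
  then show ?thesis by blast
qed

section \<open>Singular pencils and equipotent submatrices\<close>

text \<open>With the weights as a parameter, \<open>DE_mats\<close> (constant weights) and
  \<open>GDE_mats\<close> (some weights) are handled by the same argument.\<close>

definition equipotent_wrt :: "(nat \<Rightarrow> real) \<Rightarrow> nat \<Rightarrow> complex mat \<Rightarrow> bool" where
  "equipotent_wrt \<beta> k B \<longleftrightarrow> (\<forall>r<k. \<beta> r > 0) \<and>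
     (\<forall>r<k. \<beta> r * cmod (B $$ (r,r)) = (\<Sum>s\<in>{..<k} - {r}. \<beta> s * cmod (B $$ (r,s))))"

lemma GDE_mats_iff: "B \<in> GDE_mats k \<longleftrightarrow> B \<in> carrier_mat k k \<and> (\<exists>\<beta>. equipotent_wrt \<beta> k B)"
  by (auto simp: GDE_mats_def equipotent_wrt_def)

lemma DE_mats_iff: "B \<in> DE_mats k \<longleftrightarrow> B \<in> carrier_mat k k \<and> equipotent_wrt (\<lambda>_. 1) k B"
  by (auto simp: DE_mats_def equipotent_wrt_def)

text \<open>Scaling divides both sides of the equation of row \<open>r\<close> by
  \<open>cmod (B $$ (r,r))\<close>.\<close>

lemma equipotent_wrt_row_scaled:
  assumes B: "B \<in> carrier_mat k k" and d: "\<And>i. i < k \<Longrightarrow> B $$ (i,i) \<noteq> 0"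
  shows "equipotent_wrt \<beta> k (mat_inv (diag_part B) * B) \<longleftrightarrow> equipotent_wrt \<beta> k B"
proof -
  let ?N = "mat_inv (diag_part B) * B"
  have "\<beta> r * cmod (?N $$ (r,r)) = (\<Sum>s\<in>{..<k} - {r}. \<beta> s * cmod (?N $$ (r,s))) \<longleftrightarrow>
        \<beta> r * cmod (B $$ (r,r)) = (\<Sum>s\<in>{..<k} - {r}. \<beta> s * cmod (B $$ (r,s)))"
    if r: "r < k" for r
  proof -
    have sum: "(\<Sum>s\<in>{..<k} - {r}. \<beta> s * cmod (?N $$ (r,s))) =
        (\<Sum>s\<in>{..<k} - {r}. \<beta> s * cmod (B $$ (r,s))) / cmod (B $$ (r,r))"
      unfolding sum_divide_distrib
      using row_scaled_carrier_index(2)[OF B d r] by (intro sum.cong) (auto simp: norm_divide)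
    show ?thesis
      unfolding sum using row_scaled_carrier_index(2)[OF B d r r] d[OF r]
      by (simp add: nonzero_eq_divide_eq)
  qed
  then show ?thesis
    by (auto simp: equipotent_wrt_def)
qed

context fgs
begin

definition dominant_wrt :: "(nat \<Rightarrow> real) \<Rightarrow> bool" where
  "dominant_wrt \<alpha> \<longleftrightarrow> (\<forall>i<n. \<alpha> i > 0) \<and>
     (\<forall>i<n. (\<Sum>j\<in>{..<n} - {i}. \<alpha> j * cmod (A $$ (i,j))) \<le> \<alpha> i * cmod (A $$ (i,i)))"

abbreviation sub :: "nat set \<Rightarrow> complex mat" where
  "sub I \<equiv> principal_submatrix A I"

lemma sub_diag: "I \<subseteq> {..<n} \<Longrightarrow> r < card I \<Longrightarrow> sub I $$ (r,r) \<noteq> 0"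
  using principal_submatrix_index[OF A, of I r r] pick_in_set_le[of r I] diag by auto

text \<open>Divided by \<open>\<mu>\<close>, row \<open>i\<close> of the kernel equation is an
  instance of \<open>dominated_row_equality\<close> with bounds
  \<open>p j = c * \<alpha> j\<close>.\<close>

lemma extremal_row:
  assumes dom: "dominant_wrt \<alpha>" and v: "v \<in> carrier_vec n"
    and ker: "fgs_pencil A \<mu> *\<^sub>v v = 0\<^sub>v n" and \<mu>: "1 \<le> cmod \<mu>"
    and c: "c > 0" and le: "\<And>j. j < n \<Longrightarrow> cmod (v $ j) \<le> c * \<alpha> j"
    and i: "i < n" and vi: "cmod (v $ i) = c * \<alpha> i"
  shows "\<alpha> i * cmod (A $$ (i,i)) = (\<Sum>j\<in>{..<n} - {i}. \<alpha> j * cmod (A $$ (i,j)))"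
    and "\<And>j. j < n \<Longrightarrow> j \<noteq> i \<Longrightarrow> A $$ (i,j) \<noteq> 0 \<Longrightarrow>
      cmod (v $ j) = c * \<alpha> j \<and> (i < j \<longrightarrow> cmod \<mu> = 1) \<and>
      A $$ (i,j) * v $ j * (if i < j then inverse \<mu> else 1) =
        - of_real (cmod (A $$ (i,j)) * (c * \<alpha> j)) * sgn (A $$ (i,i) * v $ i)"
proof -
  \<comment> \<open>Division of the row by \<open>\<mu>\<close> leaves the factor
    \<open>inverse \<mu>\<close> only above the diagonal. Its modulus is at most 1, so absorbing it
    into \<open>w\<close> keeps the bound on \<open>v\<close>.\<close>
  define w where "w j = (if i < j then inverse \<mu> else 1) * v $ j" for j
  let ?T = "{..<n} - {i}"
  have \<alpha>: "\<alpha> j > 0" if "j < n" for j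
    using dom that by (simp add: dominant_wrt_def)
  have w_le_v: "cmod (w j) \<le> cmod (v $ j)" for j
    using \<mu> by (auto simp: w_def norm_mult norm_inverse intro!: mult_left_le_one_le inverse_le_1_iff[THEN iffD2])
  have "(\<Sum>j<n. (if i < j then 1 else \<mu>) * A $$ (i,j) * v $ j) = 0"
    using fgs_pencil_mult_vec[OF A v i, of \<mu>] ker i by simp
  moreover have \<mu>0: "inverse \<mu> * \<mu> = 1"
    using \<mu> by (intro left_inverse) auto
  ultimately have "inverse \<mu> * (\<Sum>j<n. (if i < j then 1 else \<mu>) * A $$ (i,j) * v $ j) = 0"
    by simp
  moreover have "inverse \<mu> * ((if i < j then 1 else \<mu>) * A $$ (i,j) * v $ j) = A $$ (i,j) * w j" for j
    using \<mu>0 by (simp add: w_def mult.assoc[symmetric])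
  ultimately have "(\<Sum>j<n. A $$ (i,j) * w j) = 0"
    by (simp add: sum_distrib_left del: mult_eq_0_iff)
  then have zero: "A $$ (i,i) * v $ i + (\<Sum>j\<in>?T. A $$ (i,j) * w j) = 0"
    using i sum.remove[of "{..<n}" i "\<lambda>j. A $$ (i,j) * w j"] by (simp add: w_def)
  have wle: "cmod (w j) \<le> c * \<alpha> j" if "j \<in> ?T" for j
    using le[of j] w_le_v[of j] that by simp
  have sum: "(\<Sum>j\<in>?T. c * \<alpha> j * cmod (A $$ (i,j))) = c * (\<Sum>j\<in>?T. \<alpha> j * cmod (A $$ (i,j)))"
    by (simp add: sum_distrib_left mult.assoc)
  have "c * (\<Sum>j\<in>?T. \<alpha> j * cmod (A $$ (i,j))) \<le> c * (\<alpha> i * cmod (A $$ (i,i)))"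
    using dom i c by (intro mult_left_mono) (auto simp: dominant_wrt_def)
  then have "(\<Sum>j\<in>?T. c * \<alpha> j * cmod (A $$ (i,j))) \<le> cmod (v $ i) * cmod (A $$ (i,i))"
    unfolding sum vi by (simp only: mult.assoc)
  note eq = dominated_row_equality[OF finite_Diff[OF finite_lessThan] zero wle this]
  show "\<alpha> i * cmod (A $$ (i,i)) = (\<Sum>j\<in>?T. \<alpha> j * cmod (A $$ (i,j)))"
    using eq(1) c unfolding sum vi by (simp add: mult.assoc)
  fix j assume j: "j < n" "j \<noteq> i" "A $$ (i,j) \<noteq> 0"
  then have wj: "cmod (w j) = c * \<alpha> j"
    using eq(2)[of j] by auto
  have vj: "cmod (v $ j) = c * \<alpha> j"
    using wj w_le_v[of j] le[OF j(1)] by linarith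
  \<comment> \<open>Both \<open>v\<close> and its shrunken version \<open>w\<close> attain the same
    positive bound at \<open>j\<close>, so nothing was shrunk.\<close>
  have "cmod \<mu> = 1" if "i < j"
  proof -
    have "cmod (w j) = cmod (v $ j) / cmod \<mu>"
      using that by (simp add: w_def norm_mult norm_inverse divide_inverse)
    then have "c * \<alpha> j = c * \<alpha> j / cmod \<mu>"
      using wj vj by simp
    moreover have "cmod \<mu> \<noteq> 0" "c * \<alpha> j \<noteq> 0"
      using c \<alpha>[OF j(1)] \<mu> by auto
    ultimately show ?thesis
      by (metis nonzero_eq_divide_eq mult_cancel_left1)
  qed
  moreover have "A $$ (i,j) * w j = - of_real (cmod (A $$ (i,j) * w j)) * sgn (A $$ (i,i) * v $ i)"
    using eq(3)[of j] j by simp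
  then have "A $$ (i,j) * v $ j * (if i < j then inverse \<mu> else 1) =
        - of_real (cmod (A $$ (i,j)) * (c * \<alpha> j)) * sgn (A $$ (i,i) * v $ i)"
    unfolding norm_mult wj by (simp add: w_def mult_ac)
  ultimately show "cmod (v $ j) = c * \<alpha> j \<and> (i < j \<longrightarrow> cmod \<mu> = 1) \<and>
      A $$ (i,j) * v $ j * (if i < j then inverse \<mu> else 1) =
        - of_real (cmod (A $$ (i,j)) * (c * \<alpha> j)) * sgn (A $$ (i,i) * v $ i)"
    using vj by blast
qed

text \<open>Take a closed set of least cardinality. A closed index set of its submatrix maps under
  \<open>pick\<close> to a closed set of \<open>A\<close>, which by minimality is
  everything.\<close>

lemma minimal_closed_subset:
  assumes "J \<subseteq> {..<n}" "J \<noteq> {}" "\<And>i j. i \<in> J \<Longrightarrow> j \<in> {..<n} - J \<Longrightarrow> A $$ (i,j) = 0"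
  obtains K where "K \<subseteq> J" "K \<noteq> {}" "\<And>i j. i \<in> K \<Longrightarrow> j \<in> {..<n} - K \<Longrightarrow> A $$ (i,j) = 0"
    "irreducible_mat (sub K)"
proof -
  define C where "C K \<longleftrightarrow> K \<subseteq> J \<and> K \<noteq> {} \<and> (\<forall>i\<in>K. \<forall>j\<in>{..<n} - K. A $$ (i,j) = 0)" for K
  have "C J"
    unfolding C_def using assms(1-3) by blast
  then obtain K where CK: "C K" and min: "\<And>K'. C K' \<Longrightarrow> card K \<le> card K'"
    using ex_has_least_nat[of C J card] by blast
  have sub: "K \<subseteq> {..<n}" and fin: "finite K"
    using CK assms(1) finite_subset[of K "{..<n}"] by (auto simp: C_def)
  note e = bij_betw_pick[OF fin]
  have "irreducible_mat (sub K)"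
    unfolding irreducible_mat_iff[OF principal_submatrix_carrier[OF A sub]]
  proof (intro allI impI)
    fix S assume S: "S \<subseteq> {..<card K}"
      and c: "S \<noteq> {} \<and> (\<forall>r\<in>S. \<forall>s\<in>{..<card K} - S. sub K $$ (r,s) = 0)"
    have eS: "pick K ` S \<subseteq> K"
      using S e by (auto simp: bij_betw_def)
    have "A $$ (i,j) = 0" if "i \<in> pick K ` S" "j \<in> {..<n} - pick K ` S" for i j
    proof (cases "j \<in> K")
      case True
      then have "j \<in> pick K ` {..<card K}"
        using e by (simp add: bij_betw_def)
      then obtain s where s: "s < card K" "j = pick K s"
        by blast
      obtain r where r: "r \<in> S" "i = pick K r"
        using \<open>i \<in> pick K ` S\<close> by blast
      have "s \<in> {..<card K} - S" "r < card K"
        using s r \<open>j \<in> {..<n} - pick K ` S\<close> S by auto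
      then show ?thesis
        using c r s principal_submatrix_index[OF A sub, of r s] by simp
    next
      case False
      then show ?thesis
        using CK that eS by (auto simp: C_def)
    qed
    then have "C (pick K ` S)"
      using c eS CK by (auto simp: C_def)
    then have "card K \<le> card (pick K ` S)"
      by (rule min)
    also have "\<dots> \<le> card S"
      using S finite_subset by (intro card_image_le) blast
    finally show "S = {..<card K}"
      using S by (intro card_seteq) auto
  qed
  then show thesis
    using that CK unfolding C_def by blast
qed

section \<open>From a singular pencil to an equipotent submatrix\<close>

lemma singular_pencil_imp_submatrix:
  assumes dom: "dominant_wrt \<alpha>" and \<mu>: "1 \<le> cmod \<mu>" and det: "det (fgs_pencil A \<mu>) = 0"
  obtains K u where "K \<subseteq> {..<n}" "2 \<le> card K" "irreducible_mat (sub K)"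
    "equipotent_wrt (\<lambda>r. \<alpha> (pick K r)) (card K) (sub K)"
    "ray_phases (card K) \<mu> u (mat_inv (diag_part (sub K)) * sub K)"
proof -
  have \<alpha>: "\<alpha> j > 0" if "j < n" for j
    using dom that by (simp add: dominant_wrt_def)
  obtain v where v: "v \<in> carrier_vec n" "v \<noteq> 0\<^sub>v n" and ker: "fgs_pencil A \<mu> *\<^sub>v v = 0\<^sub>v n"
    using det det_0_iff_vec_prod_zero[OF fgs_pencil_carrier[OF A]] by blast
  then obtain i0 where i0: "i0 < n" "v $ i0 \<noteq> 0"
    by (auto simp: vec_eq_iff)
  \<comment> \<open>The largest weighted modulus of \<open>v\<close>, positive because
    \<open>v\<close> is nonzero; \<open>J\<close> below collects the indices attaining it.\<close>
  define c where "c = Max ((\<lambda>j. cmod (v $ j) / \<alpha> j) ` {..<n})"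
  have ge: "cmod (v $ j) / \<alpha> j \<le> c" if "j < n" for j
    unfolding c_def using that by (intro Max_ge) auto
  have le: "cmod (v $ j) \<le> c * \<alpha> j" if "j < n" for j
    using ge[OF that] \<alpha>[OF that] by (simp add: field_simps)
  have c: "c > 0"
    using ge[OF i0(1)] i0 \<alpha>[OF i0(1)] by (meson divide_pos_pos less_le_trans zero_less_norm_iff)
  define J where "J = {j. j < n \<and> cmod (v $ j) = c * \<alpha> j}"
  have "c \<in> (\<lambda>j. cmod (v $ j) / \<alpha> j) ` {..<n}"
    unfolding c_def using i0 by (intro Max_in) auto
  then obtain j0 where "j0 < n" "c = cmod (v $ j0) / \<alpha> j0"
    by auto
  then have "j0 \<in> J"
    using \<alpha>[of j0] by (simp add: J_def)
  note row = extremal_row[OF dom v(1) ker \<mu> c le]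
  have "A $$ (i,j) = 0" if "i \<in> J" "j \<in> {..<n} - J" for i j
    using row(2)[of i j] that by (cases "i = j") (auto simp: J_def)
  then obtain K where K: "K \<subseteq> J" "K \<noteq> {}" and closed: "\<And>i j. i \<in> K \<Longrightarrow> j \<in> {..<n} - K \<Longrightarrow> A $$ (i,j) = 0"
    and irr: "irreducible_mat (sub K)"
    using \<open>j0 \<in> J\<close> by (elim minimal_closed_subset[of J, rotated 2]) (auto simp: J_def)
  have Kn: "K \<subseteq> {..<n}" and fin: "finite K"
    using K finite_subset[of K "{..<n}"] by (auto simp: J_def)
  have KJ: "i < n" "cmod (v $ i) = c * \<alpha> i" if "i \<in> K" for i
    using K that by (auto simp: J_def)
  have sumK: "\<alpha> i * cmod (A $$ (i,i)) = (\<Sum>j\<in>K - {i}. \<alpha> j * cmod (A $$ (i,j)))" if "i \<in> K" for i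
  proof -
    have "(\<Sum>j\<in>{..<n} - {i}. \<alpha> j * cmod (A $$ (i,j))) = (\<Sum>j\<in>K - {i}. \<alpha> j * cmod (A $$ (i,j)))"
      using Kn closed that by (intro sum.mono_neutral_right) auto
    then show ?thesis
      using row(1)[OF _ KJ[OF that]] KJ[OF that] by simp
  qed
  have off: "\<exists>j\<in>K - {i}. A $$ (i,j) \<noteq> 0" if "i \<in> K" for i
  proof (rule ccontr)
    assume "\<not> ?thesis"
    then have "\<alpha> i * cmod (A $$ (i,i)) = 0"
      using sumK[OF that] by simp
    then show False
      using \<alpha>[of i] diag[of i] KJ[OF that] by simp
  qed
  have \<mu>1: "cmod \<mu> = 1"
  proof -
    have m: "Min K \<in> K"
      using fin K by simp
    obtain j where j: "j \<in> K" "j \<noteq> Min K" "A $$ (Min K, j) \<noteq> 0"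
      using off[OF m] by auto
    then have "Min K < j"
      using fin by (simp add: order.not_eq_order_implies_strict)
    then show ?thesis
      using row(2)[of "Min K" j] j KJ[OF m] KJ[OF j(1)] by auto
  qed
  have card: "2 \<le> card K"
  proof -
    obtain i where i: "i \<in> K" using K by blast
    obtain j where "j \<in> K" "j \<noteq> i" using off[OF i] by auto
    then have "card {i,j} \<le> card K"
      using i fin by (intro card_mono) auto
    then show ?thesis using \<open>j \<noteq> i\<close> by simp
  qed
  let ?k = "card K" and ?e = "pick K"
  note e = bij_betw_pick[OF fin]
  have eK: "?e r \<in> K" if "r < ?k" for r
    using bij_betwE[OF e] that by auto
  note idx = principal_submatrix_index[OF A Kn]
  note B = principal_submatrix_carrier[OF A Kn]
  have equi: "equipotent_wrt (\<lambda>r. \<alpha> (?e r)) ?k (sub K)"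
    unfolding equipotent_wrt_def
  proof (intro conjI allI impI)
    fix r assume r: "r < ?k"
    show "\<alpha> (?e r) > 0"
      using \<alpha> KJ eK[OF r] by auto
    have "bij_betw ?e ({..<?k} - {r}) (K - {?e r})"
      using bij_betw_DiffI[OF e, of "{r}" "{?e r}"] r eK[OF r] by simp
    from sum.reindex_bij_betw[OF this, of "\<lambda>j. \<alpha> j * cmod (A $$ (?e r, j))"]
    show "\<alpha> (?e r) * cmod (sub K $$ (r,r)) = (\<Sum>s\<in>{..<?k} - {r}. \<alpha> (?e s) * cmod (sub K $$ (r,s)))"
      using sumK[OF eK[OF r]] r by (simp add: idx)
  qed
  define u where "u r = sgn (v $ (?e r))" for r
  have "ray_phases ?k \<mu> u (mat_inv (diag_part (sub K)) * sub K)"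
    unfolding ray_phases_def
  proof (intro conjI allI impI)
    show "cmod \<mu> = 1" by fact
  next
    fix r assume r: "r < ?k"
    have "cmod (v $ (?e r)) > 0"
      using KJ[OF eK[OF r]] c \<alpha>[of "?e r"] by simp
    then show "cmod (u r) = 1"
      by (simp add: u_def norm_sgn)
  next
    fix r s assume rs: "r < ?k" "s < ?k" "r \<noteq> s"
    let ?N = "mat_inv (diag_part (sub K)) * sub K"
    let ?i = "?e r" and ?j = "?e s"
    have N: "?N $$ (r,s) = A $$ (?i,?j) / A $$ (?i,?i)"
      using row_scaled_carrier_index(2)[OF B sub_diag[OF Kn] rs(1,2)] rs by (simp add: idx)
    have ij: "?i < n" "?j < n" "?i \<noteq> ?j" "?i < ?j \<longleftrightarrow> r < s"
      using eK KJ rs pick_less_iff[of r K s] pick_less_iff[of s K r] by auto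
    show "?N $$ (r,s) = of_real (cmod (?N $$ (r,s))) * (- (u r / u s) * (if r < s then \<mu> else 1))"
    proof (cases "A $$ (?i,?j) = 0")
      case False
      let ?l = "if r < s then \<mu> else 1"
      let ?q = "of_real (c * \<alpha> ?j) :: complex"
      have l: "?l \<noteq> 0"
        using \<mu> by auto
      have vj: "cmod (v $ ?j) = c * \<alpha> ?j" "c * \<alpha> ?j > 0"
        using KJ[OF eK[OF rs(2)]] c \<alpha>[OF ij(2)] by auto
      have q: "?q \<noteq> 0"
        using vj(2) by (metis of_real_eq_0_iff less_irrefl)
      \<comment> \<open>Polar form: on \<open>K\<close> the modulus of \<open>v\<close> is known, so
        the positive factor \<open>?q\<close> cancels from the row identity and only phases
        remain.\<close>
      have us: "v $ ?j = ?q * u s" "u s \<noteq> 0"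
        using vj by (auto simp: u_def sgn_eq sgn_zero_iff)
      have "A $$ (?i,?j) * v $ ?j * inverse ?l =
          - of_real (cmod (A $$ (?i,?j)) * (c * \<alpha> ?j)) * sgn (A $$ (?i,?i) * v $ ?i)"
        using row(2)[of ?i ?j] ij False KJ(2)[OF eK[OF rs(1)]] by (auto split: if_splits)
      then have "?q * (A $$ (?i,?j) * u s * inverse ?l) =
          ?q * (- of_real (cmod (A $$ (?i,?j))) * (sgn (A $$ (?i,?i)) * u r))"
        unfolding us(1) by (simp add: u_def sgn_mult mult_ac)
      then have "A $$ (?i,?j) * u s * inverse ?l =
          - of_real (cmod (A $$ (?i,?j))) * (sgn (A $$ (?i,?i)) * u r)"
        by (rule mult_left_cancel[THEN iffD1, OF q])
      then have "A $$ (?i,?j) = - of_real (cmod (A $$ (?i,?j))) * sgn (A $$ (?i,?i)) * (u r / u s) * ?l"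
        using us(2) l by (simp add: field_simps)
      then have "A $$ (?i,?j) / A $$ (?i,?i) =
          - of_real (cmod (A $$ (?i,?j))) * (sgn (A $$ (?i,?i)) / A $$ (?i,?i)) * (u r / u s) * ?l"
        by (metis (no_types, lifting) times_divide_eq_left times_divide_eq_right)
      \<comment> \<open>Dividing by the diagonal entry cancels its phase; its modulus completes that
        of the scaled entry.\<close>
      also have "sgn (A $$ (?i,?i)) / A $$ (?i,?i) = inverse (of_real (cmod (A $$ (?i,?i))))"
        using diag[OF ij(1)] by (simp add: sgn_eq field_simps)
      finally show ?thesis
        unfolding N norm_divide of_real_divide
        by (simp only: divide_inverse mult_minus_left mult_minus_right mult.assoc)
    qed (simp add: N)
  qed
  with that[OF Kn card irr equi] show thesis .
qed

section \<open>From an equipotent submatrix back to a singular pencil\<close>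

text \<open>The block already exhausts the dominance of its rows, although its own weights
  \<open>\<beta>\<close> are not assumed to be related to \<open>\<alpha>\<close>; nothing is left
  for entries outside \<open>I\<close>.\<close>

lemma irreducible_GDE_closed:
  assumes dom: "dominant_wrt \<alpha>" and I: "I \<subseteq> {..<n}"
    and irr: "irreducible_mat (sub I)" and equi: "equipotent_wrt \<beta> (card I) (sub I)"
    and i: "i \<in> I" and j: "j \<in> {..<n} - I"
  shows "A $$ (i,j) = 0"
proof -
  let ?k = "card I" and ?e = "pick I"
  have fin: "finite I"
    using I finite_subset by blast
  note e = bij_betw_pick[OF fin]
  have eI: "?e r \<in> I" "?e r < n" if "r < ?k" for r
    using bij_betwE[OF e] I that by auto
  note idx = principal_submatrix_index[OF A I]
  have \<alpha>: "\<alpha> l > 0" if "l < n" for l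
    using dom that by (simp add: dominant_wrt_def)
  have \<beta>: "\<beta> r > 0" if "r < ?k" for r
    using equi that by (simp add: equipotent_wrt_def)
  have k: "0 < ?k"
    using i fin card_gt_0_iff by blast
  \<comment> \<open>The smallest ratio of the two weights: \<open>c * \<beta>\<close> lies below
    \<open>\<alpha>\<close> on the block and touches it exactly on \<open>S\<close>.\<close>
  define c where "c = Min ((\<lambda>r. \<alpha> (?e r) / \<beta> r) ` {..<?k})"
  have c_le: "c \<le> \<alpha> (?e r) / \<beta> r" if "r < ?k" for r
    unfolding c_def using that by (intro Min_le) auto
  have le: "c * \<beta> r \<le> \<alpha> (?e r)" if "r < ?k" for r
    using c_le[OF that] \<beta>[OF that] by (simp add: field_simps)
  define S where "S = {r. r < ?k \<and> \<alpha> (?e r) = c * \<beta> r}"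
  \<comment> \<open>In a row of \<open>S\<close>, the diagonal term equals the block sum with
    weights \<open>c * \<beta>\<close>, which is at most the block sum with weights
    \<open>\<alpha>\<close>, hence at most the full row sum, hence at most the diagonal term.
    Equality in the first bound makes \<open>S\<close> closed within the block, equality in the
    second kills the entries outside \<open>I\<close>.\<close>
  have row: "(\<forall>s\<in>{..<?k} - {r}. sub I $$ (r,s) = 0 \<or> s \<in> S) \<and> (\<forall>l\<in>{..<n} - I. A $$ (?e r, l) = 0)"
    if r: "r \<in> S" for r
  proof -
    have rk: "r < ?k" and req: "\<alpha> (?e r) = c * \<beta> r"
      using r by (auto simp: S_def)
    let ?f = "\<lambda>l. \<alpha> l * cmod (A $$ (?e r, l))"
    let ?g = "\<lambda>s. \<alpha> (?e s) * cmod (sub I $$ (r,s))" and ?h = "\<lambda>s. c * \<beta> s * cmod (sub I $$ (r,s))"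
    let ?T = "{..<?k} - {r}"
    have "bij_betw ?e ?T (I - {?e r})"
      using bij_betw_DiffI[OF e, of "{r}" "{?e r}"] rk eI[OF rk] by simp
    from sum.reindex_bij_betw[OF this, of ?f]
    have 1: "sum ?f (I - {?e r}) = sum ?g ?T"
      using rk by (simp add: idx)
    have "{..<n} - {?e r} = (I - {?e r}) \<union> ({..<n} - I)"
      using I eI[OF rk] by auto
    then have 2: "sum ?f ({..<n} - {?e r}) = sum ?f (I - {?e r}) + sum ?f ({..<n} - I)"
      using fin sum.union_disjoint[of "I - {?e r}" "{..<n} - I" ?f] by auto
    have 3: "sum ?f ({..<n} - {?e r}) \<le> \<alpha> (?e r) * cmod (A $$ (?e r, ?e r))"
      using dom eI[OF rk] by (simp add: dominant_wrt_def)
    have "\<beta> r * cmod (sub I $$ (r,r)) = (\<Sum>s\<in>?T. \<beta> s * cmod (sub I $$ (r,s)))"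
      using equi rk by (simp add: equipotent_wrt_def)
    then have 4: "\<alpha> (?e r) * cmod (A $$ (?e r, ?e r)) = sum ?h ?T"
      using rk by (simp add: req idx sum_distrib_left[symmetric] mult.assoc)
    have hg: "?h s \<le> ?g s" if "s \<in> ?T" for s
      using le[of s] that by (intro mult_right_mono) auto
    then have 5: "sum ?h ?T \<le> sum ?g ?T"
      by (intro sum_mono)
    have f0: "0 \<le> ?f l" if "l \<in> {..<n} - I" for l
      using \<alpha>[of l] that by simp
    then have 6: "0 \<le> sum ?f ({..<n} - I)"
      by (intro sum_nonneg)
    have "sum ?h ?T = sum ?g ?T"
      using 1 2 3 4 5 6 by linarith
    then have hg_eq: "?h s = ?g s" if "s \<in> ?T" for s
      using sum_mono_inv[of ?h ?T ?g s] hg that by simp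
    have a: "sub I $$ (r,s) = 0 \<or> s \<in> S" if "s \<in> ?T" for s
    proof -
      have "c * \<beta> s = \<alpha> (?e s) \<or> cmod (sub I $$ (r,s)) = 0"
        using hg_eq[OF that] by (simp only: mult_cancel_right) blast
      then show ?thesis
        using that unfolding S_def by auto
    qed
    have "sum ?f ({..<n} - I) = 0"
      using 1 2 3 4 5 6 by linarith
    then have "?f l = 0" if "l \<in> {..<n} - I" for l
      using f0 that sum_nonneg_eq_0_iff[of "{..<n} - I" ?f] by blast
    then have "A $$ (?e r, l) = 0" if "l \<in> {..<n} - I" for l
      using \<alpha>[of l] that by fastforce
    with a show ?thesis by blast
  qed
  have "c \<in> (\<lambda>r. \<alpha> (?e r) / \<beta> r) ` {..<?k}"
    unfolding c_def using k by (intro Min_in) auto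
  then obtain r0 where "r0 < ?k" "c = \<alpha> (?e r0) / \<beta> r0"
    by auto
  then have "r0 \<in> S"
    using \<beta>[of r0] by (simp add: S_def)
  moreover have "S \<subseteq> {..<?k}"
    by (auto simp: S_def)
  moreover have "\<forall>r\<in>S. \<forall>s\<in>{..<?k} - S. sub I $$ (r,s) = 0"
    using row by blast
  ultimately have "S = {..<?k}"
    using irr unfolding irreducible_mat_iff[OF principal_submatrix_carrier[OF A I]] by blast
  moreover obtain r where "r < ?k" "i = ?e r"
    using e i by (auto simp: bij_betw_def)
  ultimately show ?thesis
    using row[of r] j by blast
qed

lemma submatrix_imp_singular_pencil:
  assumes dom: "dominant_wrt \<alpha>" and I: "I \<subseteq> {..<n}" "0 < card I"
    and irr: "irreducible_mat (sub I)" and equi: "equipotent_wrt \<beta> (card I) (sub I)"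
    and ph: "ray_phases (card I) \<mu> u (mat_inv (diag_part (sub I)) * sub I)"
  shows "det (fgs_pencil A \<mu>) = 0"
proof -
  let ?k = "card I" and ?e = "pick I" and ?B = "sub I"
  let ?N = "mat_inv (diag_part ?B) * ?B"
  have fin: "finite I"
    using I finite_subset by blast
  note e = bij_betw_pick[OF fin]
  have eI: "?e r < n" if "r < ?k" for r
    using bij_betwE[OF e] I that by auto
  note idx = principal_submatrix_index[OF A I(1)]
  note B = principal_submatrix_carrier[OF A I(1)]
  note P = fgs_pencil_carrier[OF A, of \<mu>]
  have closed: "fgs_pencil A \<mu> $$ (i,j) = 0" if "i \<in> I" "j \<in> {..<n} - I" for i j
    using irreducible_GDE_closed[OF dom I(1) irr equi that] that A I by (auto simp: fgs_pencil_def)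
  \<comment> \<open>Taking the pencil commutes with taking principal submatrices because
    \<open>pick\<close> preserves the order.\<close>
  have Q: "submatrix (fgs_pencil A \<mu>) I I = fgs_pencil ?B \<mu>"
  proof (rule eq_matI)
    fix r s assume "r < dim_row (fgs_pencil ?B \<mu>)" "s < dim_col (fgs_pencil ?B \<mu>)"
    then have rs: "r < ?k" "s < ?k"
      using B by (auto simp: fgs_pencil_def)
    then show "submatrix (fgs_pencil A \<mu>) I I $$ (r,s) = fgs_pencil ?B \<mu> $$ (r,s)"
      using principal_submatrix_index[OF P I(1) rs] idx[OF rs] pick_less_iff[OF rs] eI A B
      by (auto simp: fgs_pencil_def)
  qed (simp_all add: carrier_matD[OF principal_submatrix_carrier[OF P I(1)]] carrier_matD[OF fgs_pencil_carrier[OF B]])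
  define v where "v = vec ?k (\<lambda>r. of_real (\<beta> r) * u r)"
  have v: "v \<in> carrier_vec ?k"
    by (simp add: v_def)
  have u: "u r \<noteq> 0" if "r < ?k" for r
    using ph that by (fastforce simp: ray_phases_def)
  have \<mu>: "\<mu> \<noteq> 0"
    using ph by (auto simp: ray_phases_def)
  have "fgs_pencil ?B \<mu> *\<^sub>v v = 0\<^sub>v ?k"
  proof (rule eq_vecI)
    fix r assume "r < dim_vec (0\<^sub>v ?k :: complex vec)"
    then have r: "r < ?k" by simp
    let ?b = "?B $$ (r,r)"
    have b: "?b \<noteq> 0"
      using sub_diag[OF I(1) r] .
    \<comment> \<open>The factor of the pencil and that of the ray phase multiply to
      \<open>\<mu>\<close> on either side of the diagonal, and \<open>u s\<close> cancels. All
      off-diagonal terms thus point opposite to the diagonal term, and equipotency makes them cancel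
      it.\<close>
    have entry: "(if r < s then 1 else \<mu>) * ?B $$ (r,s) * v $ s =
        - (\<mu> * u r * ?b * of_real (\<beta> s * cmod (?B $$ (r,s)) / cmod ?b))" if "s \<in> {..<?k} - {r}" for s
    proof -
      have s: "s < ?k" "r \<noteq> s" using that by auto
      have N: "?N $$ (r,s) = ?B $$ (r,s) / ?b"
        using row_scaled_carrier_index(2)[OF B sub_diag[OF I(1)] r s(1)] .
      have "?N $$ (r,s) = of_real (cmod (?N $$ (r,s))) * (- (u r / u s) * (if r < s then \<mu> else 1))"
        using ph r s by (simp add: ray_phases_def)
      then have "?B $$ (r,s) / ?b = of_real (cmod (?B $$ (r,s)) / cmod ?b) * (- (u r / u s) * (if r < s then \<mu> else 1))"
        unfolding N norm_divide .
      then have "?B $$ (r,s) = ?b * (of_real (cmod (?B $$ (r,s)) / cmod ?b) * (- (u r / u s) * (if r < s then \<mu> else 1)))"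
        using b by (metis nonzero_mult_div_cancel_left times_divide_eq_right)
      then have "(if r < s then 1 else \<mu>) * ?B $$ (r,s) * v $ s =
         (if r < s then 1 else \<mu>) * (?b * (of_real (cmod (?B $$ (r,s)) / cmod ?b) * (- (u r / u s) * (if r < s then \<mu> else 1)))) * v $ s"
        by (rule arg_cong[where f = "\<lambda>z. (if r < s then 1 else \<mu>) * z * v $ s"])
      also have "\<dots> = - (\<mu> * u r * ?b * of_real (\<beta> s * cmod (?B $$ (r,s)) / cmod ?b))"
        using s u[OF s(1)] by (simp add: v_def)
      finally show ?thesis .
    qed
    have "(fgs_pencil ?B \<mu> *\<^sub>v v) $ r = (\<Sum>s<?k. (if r < s then 1 else \<mu>) * ?B $$ (r,s) * v $ s)"
      by (rule fgs_pencil_mult_vec[OF B v r])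
    also have "\<dots> = \<mu> * ?b * v $ r + (\<Sum>s\<in>{..<?k} - {r}. (if r < s then 1 else \<mu>) * ?B $$ (r,s) * v $ s)"
      using r by (subst sum.remove[of _ r]) auto
    also have "(\<Sum>s\<in>{..<?k} - {r}. (if r < s then 1 else \<mu>) * ?B $$ (r,s) * v $ s) =
        - (\<mu> * u r * ?b * of_real ((\<Sum>s\<in>{..<?k} - {r}. \<beta> s * cmod (?B $$ (r,s))) / cmod ?b))"
      unfolding sum_divide_distrib of_real_sum sum_distrib_left sum_negf[symmetric]
      by (intro sum.cong refl entry)
    also have "(\<Sum>s\<in>{..<?k} - {r}. \<beta> s * cmod (?B $$ (r,s))) = \<beta> r * cmod ?b"
      using equi r by (simp add: equipotent_wrt_def)
    also have "\<mu> * ?b * v $ r + - (\<mu> * u r * ?b * of_real (\<beta> r * cmod ?b / cmod ?b)) = 0"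
      using b r by (simp add: v_def)
    finally show "(fgs_pencil ?B \<mu> *\<^sub>v v) $ r = 0\<^sub>v ?k $ r"
      using r by simp
  qed (use fgs_pencil_carrier[OF B] in auto)
  moreover have "v \<noteq> 0\<^sub>v ?k"
  proof
    assume "v = 0\<^sub>v ?k"
    then have "v $ 0 = 0"
      using I(2) by simp
    moreover have "\<beta> 0 > 0"
      using equi I(2) by (simp add: equipotent_wrt_def)
    ultimately show False
      using I(2) u[of 0] by (simp add: v_def)
  qed
  ultimately have "det (submatrix (fgs_pencil A \<mu>) I I) = 0"
    using v unfolding Q det_0_iff_vec_prod_zero[OF fgs_pencil_carrier[OF B]] by blast
  then show ?thesis
    using det_eq_0_of_closed_principal_submatrix[OF P I(1) closed] by blast
qed

text \<open>For \<open>k = 2\<close> the ray-pattern condition holds automatically, so conditions (i) and (ii) of the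
  theorem merge into a single one for \<open>k \<ge> 2\<close>.\<close>

lemma spectral_radius_less_1_iff:
  assumes n: "0 < n" and dom: "dominant_wrt \<alpha>"
    and E_GDE: "\<And>k. E k \<subseteq> GDE_mats k"
    and equi_E: "\<And>K. K \<subseteq> {..<n} \<Longrightarrow> equipotent_wrt (\<lambda>r. \<alpha> (pick K r)) (card K) (sub K) \<Longrightarrow> sub K \<in> E (card K)"
    and scale: "\<And>k B. B \<in> carrier_mat k k \<Longrightarrow> (\<And>i. i < k \<Longrightarrow> B $$ (i,i) \<noteq> 0) \<Longrightarrow>
      mat_inv (diag_part B) * B \<in> E k \<longleftrightarrow> B \<in> E k"
  shows "spectral_radius (H_FGS A) < 1 \<longleftrightarrow>
    \<not> (\<exists>I\<subseteq>{..<n}. card I = 2 \<and> irreducible_mat (sub I) \<and> sub I \<in> E 2) \<and>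
    \<not> (\<exists>I\<subseteq>{..<n}. \<exists>k. card I = k \<and> 3 \<le> k \<and> k \<le> n \<and> irreducible_mat (sub I) \<and>
        (\<exists>\<psi>. mat_inv (diag_part (sub I)) * sub I \<in> U_mats \<psi> k \<inter> E k))"
    (is "_ \<longleftrightarrow> \<not> ?i \<and> \<not> ?ii")
proof -
  let ?N = "\<lambda>I. mat_inv (diag_part (sub I)) * sub I"
  have U: "(\<exists>\<psi>. ?N I \<in> U_mats \<psi> (card I)) \<longleftrightarrow> (\<exists>\<mu> u. ray_phases (card I) \<mu> u (?N I))"
    if "I \<subseteq> {..<n}" "0 < card I" for I
    using U_mats_iff_ray_phases[OF row_scaled_carrier_index(1)]
      row_scaled_carrier_index(2)[OF _ _ _ _] principal_submatrix_carrier[OF A that(1)] sub_diag[OF that(1)] that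
    by simp
  have scaleI: "?N I \<in> E (card I) \<longleftrightarrow> sub I \<in> E (card I)" if "I \<subseteq> {..<n}" for I
    using scale principal_submatrix_carrier[OF A that] sub_diag[OF that] by blast
  \<comment> \<open>In this direction any equipotency weights of the submatrix serve, and
    \<open>E_GDE\<close> supplies some.\<close>
  have sing: "\<exists>\<mu>. cmod \<mu> = 1 \<and> det (fgs_pencil A \<mu>) = 0"
    if I: "I \<subseteq> {..<n}" "0 < card I" "irreducible_mat (sub I)" "sub I \<in> E (card I)"
      and ph: "ray_phases (card I) \<mu> u (?N I)" for I \<mu> u
  proof -
    obtain \<beta> where "equipotent_wrt \<beta> (card I) (sub I)"
      using I(4) E_GDE[of "card I"] GDE_mats_iff by blast
    then have "det (fgs_pencil A \<mu>) = 0"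
      using submatrix_imp_singular_pencil[OF dom I(1-3)] ph by blast
    then show ?thesis
      using ph by (auto simp: ray_phases_def)
  qed
  have eig: "spectral_radius (H_FGS A) < 1 \<longleftrightarrow> \<not> (\<exists>\<mu>. 1 \<le> cmod \<mu> \<and> det (fgs_pencil A \<mu>) = 0)"
    unfolding spectral_radius_less_iff[OF H_carrier n] eigenvalue_H_iff by (auto simp: not_le[symmetric])
  have "(\<exists>\<mu>. 1 \<le> cmod \<mu> \<and> det (fgs_pencil A \<mu>) = 0) \<longleftrightarrow> ?i \<or> ?ii"
  proof
    assume "\<exists>\<mu>. 1 \<le> cmod \<mu> \<and> det (fgs_pencil A \<mu>) = 0"
    then obtain K u \<mu> where K: "K \<subseteq> {..<n}" "2 \<le> card K" "irreducible_mat (sub K)"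
      "equipotent_wrt (\<lambda>r. \<alpha> (pick K r)) (card K) (sub K)" and ph: "ray_phases (card K) \<mu> u (?N K)"
      using singular_pencil_imp_submatrix[OF dom] by metis
    \<comment> \<open>The submatrix obtained is equipotent for the restriction of the dominance
      weights \<open>\<alpha>\<close> themselves, which is what makes it fall into the smaller class
      when \<open>E\<close> is \<open>DE_mats\<close>.\<close>
    have E: "sub K \<in> E (card K)"
      using equi_E K by blast
    have Kn: "card K \<le> n"
      using card_mono[OF _ K(1)] by simp
    show "?i \<or> ?ii"
    proof (cases "card K = 2")
      case True
      then have ?i
        using K E by auto
      then show ?thesis ..
    next
      case False
      moreover have "\<exists>\<psi>. ?N K \<in> U_mats \<psi> (card K)"
        using U[OF K(1)] K(2) ph by auto
      ultimately have ?ii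
        using K E scaleI[OF K(1)] Kn by (intro exI[of _ K]) auto
      then show ?thesis ..
    qed
  next
    assume "?i \<or> ?ii"
    then show "\<exists>\<mu>. 1 \<le> cmod \<mu> \<and> det (fgs_pencil A \<mu>) = 0"
    proof
      assume ?i
      then obtain I where I: "I \<subseteq> {..<n}" "card I = 2" "irreducible_mat (sub I)" "sub I \<in> E 2"
        by blast
      have B: "sub I \<in> carrier_mat 2 2" and d: "\<And>r. r < 2 \<Longrightarrow> sub I $$ (r,r) \<noteq> 0"
        using principal_submatrix_carrier[OF A I(1)] sub_diag[OF I(1)] I(2) by auto
      obtain \<beta> where \<beta>: "equipotent_wrt \<beta> 2 (sub I)"
        using I(4) E_GDE[of 2] GDE_mats_iff by blast
      have [simp]: "{..<2} - {0::nat} = {1}" "{..<2} - {1::nat} = {0}" "{..<2} - {Suc 0} = {0}"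
        by auto
      \<comment> \<open>A zero off-diagonal entry would, by equipotency, make the diagonal entry of
        its row zero.\<close>
      have "sub I $$ (0,1) \<noteq> 0"
      proof
        assume "sub I $$ (0,1) = 0"
        then have "\<beta> 0 * cmod (sub I $$ (0,0)) = 0"
          using \<beta> by (simp add: equipotent_wrt_def)
        moreover have "\<beta> 0 > 0"
          using \<beta> by (simp add: equipotent_wrt_def)
        ultimately show False
          using d[of 0] by simp
      qed
      moreover have "sub I $$ (1,0) \<noteq> 0"
      proof
        assume "sub I $$ (1,0) = 0"
        then have "\<beta> 1 * cmod (sub I $$ (1,1)) = 0"
          using \<beta> by (simp add: equipotent_wrt_def)
        moreover have "\<beta> 1 > 0"
          using \<beta> by (simp add: equipotent_wrt_def)
        ultimately show False
          using d[of 1] by simp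
      qed
      ultimately have "?N I $$ (0,1) \<noteq> 0" "?N I $$ (1,0) \<noteq> 0"
        using row_scaled_carrier_index(2)[OF B d] d[of 0] d[of 1] by simp_all
      then obtain \<mu> u where "ray_phases (card I) \<mu> u (?N I)"
        unfolding I(2) using ray_phases_two by blast
      then have "\<exists>\<mu>. cmod \<mu> = 1 \<and> det (fgs_pencil A \<mu>) = 0"
        using sing[OF I(1) _ I(3)] I(2,4) by simp
      then show ?thesis
        by (metis order_refl)
    next
      assume ?ii
      then obtain I \<psi> where I: "I \<subseteq> {..<n}" "3 \<le> card I" "irreducible_mat (sub I)"
        and N: "?N I \<in> U_mats \<psi> (card I)" "?N I \<in> E (card I)"
        by blast
      have k: "0 < card I"
        using I(2) by simp
      obtain \<mu> u where "ray_phases (card I) \<mu> u (?N I)"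
        using U[OF I(1) k] N(1) by blast
      then have "\<exists>\<mu>. cmod \<mu> = 1 \<and> det (fgs_pencil A \<mu>) = 0"
        using sing[OF I(1) k I(3)] N(2) scaleI[OF I(1)] by blast
      then show ?thesis
        by (metis order_refl)
    qed
  qed
  then show ?thesis
    unfolding eig by blast
qed

end

section \<open>The criterion for both dominance classes\<close>

theorem theorem4p20:
  fixes A :: "complex mat" and n :: nat
  assumes "n \<ge> 1"
    and "A \<in> carrier_mat n n"
    and "\<And>i. i < n \<Longrightarrow> A $$ (i,i) \<noteq> 0"
  shows
    "(A \<in> D_mats n \<longrightarrow>
        (\<forall>b\<in>carrier_vec n. spectral_radius (H_FGS A) < 1 \<longleftrightarrow> fgs_converges n A b) \<and>
        (spectral_radius (H_FGS A) < 1 \<longleftrightarrow>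
           \<not> (\<exists>I\<subseteq>{..<n}. card I = 2 \<and> irreducible_mat (principal_submatrix A I)
                \<and> principal_submatrix A I \<in> DE_mats 2) \<and>
           \<not> (\<exists>I\<subseteq>{..<n}. \<exists>k. card I = k \<and> 3 \<le> k \<and> k \<le> n \<and>
                irreducible_mat (principal_submatrix A I) \<and>
                (\<exists>\<psi>. mat_inv (diag_part (principal_submatrix A I)) * principal_submatrix A I
                        \<in> U_mats \<psi> k \<inter> DE_mats k)))) \<and>
     (A \<in> GD_mats n \<longrightarrow>
        (\<forall>b\<in>carrier_vec n. spectral_radius (H_FGS A) < 1 \<longleftrightarrow> fgs_converges n A b) \<and>
        (spectral_radius (H_FGS A) < 1 \<longleftrightarrow>
           \<not> (\<exists>I\<subseteq>{..<n}. card I = 2 \<and> irreducible_mat (principal_submatrix A I)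
                \<and> principal_submatrix A I \<in> GDE_mats 2) \<and>
           \<not> (\<exists>I\<subseteq>{..<n}. \<exists>k. card I = k \<and> 3 \<le> k \<and> k \<le> n \<and>
                irreducible_mat (principal_submatrix A I) \<and>
                (\<exists>\<psi>. mat_inv (diag_part (principal_submatrix A I)) * principal_submatrix A I
                        \<in> U_mats \<psi> k \<inter> GDE_mats k))))"
proof -
  interpret fgs A n
    using assms by unfold_locales
  have n: "0 < n"
    using assms(1) by simp
  have conv: "\<forall>b\<in>carrier_vec n. spectral_radius (H_FGS A) < 1 \<longleftrightarrow> fgs_converges n A b"
    using fgs_converges_iff[OF n] by blast
  show ?thesis
  proof (intro conjI impI conv)
    assume "A \<in> D_mats n"
    then have "dominant_wrt (\<lambda>_. 1)"
      by (auto simp: D_mats_def dominant_wrt_def)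
    note dom = this
    show "spectral_radius (H_FGS A) < 1 \<longleftrightarrow>
           \<not> (\<exists>I\<subseteq>{..<n}. card I = 2 \<and> irreducible_mat (principal_submatrix A I)
                \<and> principal_submatrix A I \<in> DE_mats 2) \<and>
           \<not> (\<exists>I\<subseteq>{..<n}. \<exists>k. card I = k \<and> 3 \<le> k \<and> k \<le> n \<and>
                irreducible_mat (principal_submatrix A I) \<and>
                (\<exists>\<psi>. mat_inv (diag_part (principal_submatrix A I)) * principal_submatrix A I
                        \<in> U_mats \<psi> k \<inter> DE_mats k))"
    \<comment> \<open>Constant weights stay constant on every submatrix, so equipotency there is
      membership in \<open>DE_mats\<close>.\<close>
    proof (rule spectral_radius_less_1_iff[where E = DE_mats, OF n dom])
      show "DE_mats k \<subseteq> GDE_mats k" for k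
        by (auto simp: DE_mats_iff GDE_mats_iff)
      show "principal_submatrix A K \<in> DE_mats (card K)"
        if "K \<subseteq> {..<n}" "equipotent_wrt (\<lambda>r. 1) (card K) (principal_submatrix A K)" for K
        using that principal_submatrix_carrier[OF A that(1)] by (auto simp: DE_mats_iff GDE_mats_iff)
      show "mat_inv (diag_part B) * B \<in> DE_mats k \<longleftrightarrow> B \<in> DE_mats k"
        if "B \<in> carrier_mat k k" "\<And>i. i < k \<Longrightarrow> B $$ (i,i) \<noteq> 0" for k B
        using that(1) row_scaled_carrier_index(1)[OF that] equipotent_wrt_row_scaled[OF that]
        by (simp add: DE_mats_iff GDE_mats_iff)
    qed
  next
    assume "A \<in> GD_mats n"
    then obtain \<alpha> where "dominant_wrt \<alpha>"
      by (auto simp: GD_mats_def dominant_wrt_def)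
    note dom = this
    show "spectral_radius (H_FGS A) < 1 \<longleftrightarrow>
           \<not> (\<exists>I\<subseteq>{..<n}. card I = 2 \<and> irreducible_mat (principal_submatrix A I)
                \<and> principal_submatrix A I \<in> GDE_mats 2) \<and>
           \<not> (\<exists>I\<subseteq>{..<n}. \<exists>k. card I = k \<and> 3 \<le> k \<and> k \<le> n \<and>
                irreducible_mat (principal_submatrix A I) \<and>
                (\<exists>\<psi>. mat_inv (diag_part (principal_submatrix A I)) * principal_submatrix A I
                        \<in> U_mats \<psi> k \<inter> GDE_mats k))"
    \<comment> \<open>Here the weights transported along \<open>pick\<close> witness membership in
      \<open>GDE_mats\<close>.\<close>
    proof (rule spectral_radius_less_1_iff[where E = GDE_mats, OF n dom])
      show "GDE_mats k \<subseteq> GDE_mats k" for k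
        by (auto simp: DE_mats_iff GDE_mats_iff)
      show "principal_submatrix A K \<in> GDE_mats (card K)"
        if "K \<subseteq> {..<n}" "equipotent_wrt (\<lambda>r. \<alpha> (pick K r)) (card K) (principal_submatrix A K)" for K
        using that principal_submatrix_carrier[OF A that(1)] by (auto simp: DE_mats_iff GDE_mats_iff)
      show "mat_inv (diag_part B) * B \<in> GDE_mats k \<longleftrightarrow> B \<in> GDE_mats k"
        if "B \<in> carrier_mat k k" "\<And>i. i < k \<Longrightarrow> B $$ (i,i) \<noteq> 0" for k B
        using that(1) row_scaled_carrier_index(1)[OF that] equipotent_wrt_row_scaled[OF that]
        by (simp add: DE_mats_iff GDE_mats_iff)
    qed
  qed
qed

end
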